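(* Consider the compound MAC model with arbitrarily correlated sources $(S_1,S_2)$ and receiver side information $(W_1,W_2)$. Source-channel rate $b$ is achievable if there exist a random variable $Q$ with $|\mathcal{Q}|\le4$ and an input distribution $p(q,x_1,x_2)=p(q)p(x_1|q)p(x_2|q)$ such that for $k=1,2$: $$H(S_1|S_2,W_k)<b\,I(X_1;Y_k|X_2,Q),\quad H(S_2|S_1,W_k)<b\,I(X_2;Y_k|X_1,Q),\quad H(S_1,S_2|W_k)<b\,I(X_1,X_2;Y_k|Q).$$
   Context: Compound MAC model: $\{(S_{1,k},S_{2,k},W_{1,k},W_{2,k})\}_{k\ge1}$ i.i.d. $\sim p(s_1,s_2,w_1,w_2)$ on finite alphabets. Transmitter $i\in\{1,2\}$ observes $S_i^m$ and sends $X_i^n=f_i^{(m,n)}(S_i^m)$. The channel $p(y_1,y_2|x_1,x_2)$ is discrete memoryless with finite alphabets. Receiver $k\in\{1,2\}$ observes $(Y_k^n,W_k^m)$ and outputs $(\hat S_{k,1}^m,\hat S_{k,2}^m)=g_k^{(m,n)}(Y_k^n,W_k^m)$, an estimate of both sources. Error probability $P_e^{(m,n)}=\Pr\{\bigcup_{k=1,2}\{(S_1^m,S_2^m)\neq(\hat S_{k,1}^m,\hat S_{k,2}^m)\}\}$. Rate $b$ is achievable if for every $\epsilon>0$ there exist positive integers $m,n$ with $n/m=b$ and encoders/decoders with $P_e^{(m,n)}<\epsilon$.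
   Formalization: The rate b is assumed rational: achievability asks for positive integers m, n with n/m = b exactly, so an irrational b is never achievable even when all the entropy inequalities hold (e.g. constant sources over noiseless channels with b = √2). *)

theory Defs
  imports Complex_Main
begin

definition is_pmf :: "'a set \<Rightarrow> ('a \<Rightarrow> real) \<Rightarrow> bool" where
  "is_pmf \<Omega> P \<longleftrightarrow> finite \<Omega> \<and> (\<forall>\<omega>\<in>\<Omega>. 0 \<le> P \<omega>) \<and> (\<Sum>\<omega>\<in>\<Omega>. P \<omega>) = 1"

definition pr :: "'a set \<Rightarrow> ('a \<Rightarrow> real) \<Rightarrow> ('a \<Rightarrow> bool) \<Rightarrow> real" where
  "pr \<Omega> P E = (\<Sum>\<omega>\<in>\<Omega>. if E \<omega> then P \<omega> else 0)"

definition cond_entropy :: "'a set \<Rightarrow> ('a \<Rightarrow> real) \<Rightarrow> ('a \<Rightarrow> 'b) \<Rightarrow> ('a \<Rightarrow> 'c) \<Rightarrow> real" where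
  "cond_entropy \<Omega> P X Y =
     - (\<Sum>\<omega>\<in>\<Omega>. P \<omega> * log 2 (pr \<Omega> P (\<lambda>v. X v = X \<omega> \<and> Y v = Y \<omega>) / pr \<Omega> P (\<lambda>v. Y v = Y \<omega>)))"

definition cond_mutual_info ::
  "'a set \<Rightarrow> ('a \<Rightarrow> real) \<Rightarrow> ('a \<Rightarrow> 'b) \<Rightarrow> ('a \<Rightarrow> 'c) \<Rightarrow> ('a \<Rightarrow> 'd) \<Rightarrow> real" where
  "cond_mutual_info \<Omega> P X Y Z = cond_entropy \<Omega> P X Z - cond_entropy \<Omega> P X (\<lambda>\<omega>. (Y \<omega>, Z \<omega>))"

definition seqs :: "nat \<Rightarrow> 'a list set" where
  "seqs m = {xs. length xs = m}"

text \<open>Source letters are tuples (s1, s2, w1, w2); the channel W x1 x2 is a pmf on (y1, y2).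
  Encoder i maps S_i^m to X_i^n; decoder k maps (Y_k^n, W_k^m) to an estimate of (S_1^m, S_2^m).
  The error event is that at least one receiver decodes incorrectly.\<close>
definition mac_error_prob ::
  "('s1 \<times> 's2 \<times> 'w1 \<times> 'w2 \<Rightarrow> real) \<Rightarrow> ('x1 \<Rightarrow> 'x2 \<Rightarrow> 'y1 \<times> 'y2 \<Rightarrow> real) \<Rightarrow> nat \<Rightarrow> nat \<Rightarrow>
   ('s1 list \<Rightarrow> 'x1 list) \<Rightarrow> ('s2 list \<Rightarrow> 'x2 list) \<Rightarrow>
   ('y1 list \<Rightarrow> 'w1 list \<Rightarrow> 's1 list \<times> 's2 list) \<Rightarrow> ('y2 list \<Rightarrow> 'w2 list \<Rightarrow> 's1 list \<times> 's2 list) \<Rightarrow> real"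
where
  "mac_error_prob Psrc W m n f1 f2 g1 g2 =
    (\<Sum>u\<in>seqs m. prod_list (map Psrc u) *
      (let s1 = map fst u; s2 = map (fst \<circ> snd) u;
           w1 = map (fst \<circ> snd \<circ> snd) u; w2 = map (snd \<circ> snd \<circ> snd) u;
           x1 = f1 s1; x2 = f2 s2
       in (\<Sum>y\<in>seqs n. (\<Prod>j<n. W (x1 ! j) (x2 ! j) (y ! j)) *
              (if g1 (map fst y) w1 \<noteq> (s1, s2) \<or> g2 (map snd y) w2 \<noteq> (s1, s2) then 1 else 0))))"

definition achievable_rate ::
  "('s1 \<times> 's2 \<times> 'w1 \<times> 'w2 \<Rightarrow> real) \<Rightarrow> ('x1 \<Rightarrow> 'x2 \<Rightarrow> 'y1 \<times> 'y2 \<Rightarrow> real) \<Rightarrow> real \<Rightarrow> bool" where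
  "achievable_rate Psrc W b \<longleftrightarrow>
    (\<forall>\<epsilon>>0. \<exists>m n. 0 < m \<and> 0 < n \<and> real n / real m = b \<and>
       (\<exists>(f1 :: 's1 list \<Rightarrow> 'x1 list) (f2 :: 's2 list \<Rightarrow> 'x2 list)
          (g1 :: 'y1 list \<Rightarrow> 'w1 list \<Rightarrow> 's1 list \<times> 's2 list)
          (g2 :: 'y2 list \<Rightarrow> 'w2 list \<Rightarrow> 's1 list \<times> 's2 list).
          (\<forall>s\<in>seqs m. length (f1 s) = n) \<and> (\<forall>s\<in>seqs m. length (f2 s) = n) \<and>
          mac_error_prob Psrc W m n f1 f2 g1 g2 < \<epsilon>))"

end

theory Submission
  imports Defs "HOL-Library.FuncSet"
begin

text \<open>
  Random coding with a threshold decoder. Both encoders map every source word to an independently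
  drawn channel word, conditionally on a time-sharing word; a receiver looks for the pair of source
  words whose joint weight (source probability times channel likelihood) exceeds by a factor \<open>\<theta>\<close>
  its marginals over the first pair (source word, channel word), over the second pair, and over both.
  By Markov's inequality wrong candidates pass one of these three tests with total probability at most
  \<open>3 / \<theta>\<close>. The true pair fails a test only if a product of independent likelihood ratios is
  small; each of the three entropy conditions says that the mean of its logarithm is positive,
  so a Chernoff bound makes this exponentially unlikely even for a \<open>\<theta>\<close> that grows exponentially.
  Averaging the error over time-sharing words and codebooks, for both receivers at once, yields one
  good deterministic code.
\<close>

section \<open>Random codebooks and threshold decoding\<close>

text \<open>The sources are correlated and the encoders cannot cooperate, so nothing is compressed
  beforehand: the source law acts as a prior in the decoder's test and thereby removes the
  redundancy. The weight of a candidate is the source probability times the channel likelihood; the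
  code word probabilities are left out because drawing the codebook supplies them. Summing this
  weight over the letters that may be wrong gives the marginal it is compared with, so Markov's
  inequality replaces any counting of typical words. Per block of \<open>k\<close> source letters
  and \<open>l\<close> channel letters, the logarithm of weight over marginal has mean
  \<open>l * I - k * H\<close> (in nats). The rate has to equal \<open>n / m\<close> exactly, hence
  \<open>b = l / k\<close> and the lengths \<open>k * \<tau>\<close> and \<open>l * \<tau>\<close>
  with growing \<tau>. The threshold is \<open>exp (c * real \<tau>)\<close>, with \<open>c\<close>
  half of the smallest of a receiver's three slacks: large enough to make
  \<open>3 / \<theta>\<close> vanish, small enough to leave the Chernoff exponents negative. Codes
  that are good for one receiver each need not coincide. Therefore only averages are bounded per
  receiver, and the two are added before any codebook is selected.\<close>

definition code_avg :: "'a set \<Rightarrow> 'x set \<Rightarrow> ('x \<Rightarrow> real) \<Rightarrow> (('a \<Rightarrow> 'x) \<Rightarrow> real) \<Rightarrow> real" where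
  "code_avg A X p \<phi> = (\<Sum>f\<in>A \<rightarrow>\<^sub>E X. (\<Prod>a\<in>A. p (f a)) * \<phi> f)"

lemma is_pmfD:
  assumes "is_pmf X p"
  shows "finite X" "\<And>x. x \<in> X \<Longrightarrow> 0 \<le> p x" "sum p X = 1"
  using assms by (auto simp: is_pmf_def)

text \<open>The value at \<open>a\<close> is drawn separately from the rest of the codebook:
  independence enters here, and the other averages follow by splitting off one or two letters.
  Extensional functions make every codebook occur exactly once in the sum.\<close>

lemma code_avg_insert:
  assumes "finite A" "finite X" "a \<notin> A"
  shows "code_avg (insert a A) X p \<phi> = (\<Sum>x\<in>X. p x * code_avg A X p (\<lambda>f. \<phi> (f(a := x))))"
proof -
  have "code_avg (insert a A) X p \<phi> =
      (\<Sum>(x, f)\<in>X \<times> (A \<rightarrow>\<^sub>E X). (\<Prod>i\<in>insert a A. p ((f(a := x)) i)) * \<phi> (f(a := x)))"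
    unfolding code_avg_def PiE_insert_eq
    by (subst sum.reindex[OF inj_combinator[OF assms(3)]]) (simp add: case_prod_unfold)
  also have "\<dots> = (\<Sum>(x, f)\<in>X \<times> (A \<rightarrow>\<^sub>E X). p x * ((\<Prod>i\<in>A. p (f i)) * \<phi> (f(a := x))))"
  proof (intro sum.cong refl, clarify)
    fix x f assume "x \<in> X" "f \<in> A \<rightarrow>\<^sub>E X"
    have "(\<Prod>i\<in>A. p ((f(a := x)) i)) = (\<Prod>i\<in>A. p (f i))"
      using assms(3) by (intro prod.cong) auto
    then show "(\<Prod>i\<in>insert a A. p ((f(a := x)) i)) * \<phi> (f(a := x)) =
        p x * ((\<Prod>i\<in>A. p (f i)) * \<phi> (f(a := x)))"
      using assms by (simp add: mult.assoc)
  qed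
  also have "\<dots> = (\<Sum>x\<in>X. p x * code_avg A X p (\<lambda>f. \<phi> (f(a := x))))"
    by (simp add: code_avg_def sum.cartesian_product[symmetric] sum_distrib_left)
  finally show ?thesis .
qed

lemma code_avg_const:
  assumes "finite A" "is_pmf X p"
  shows "code_avg A X p (\<lambda>f. c) = c"
  using assms(1)
proof (induction A rule: finite_induct)
  case empty
  then show ?case by (simp add: code_avg_def)
next
  case (insert a A)
  then show ?case
    using is_pmfD[OF assms(2)] by (simp add: code_avg_insert sum_distrib_right[symmetric])
qed

lemma code_avg_one:
  assumes "finite A" "is_pmf X p" "a \<in> A"
  shows "code_avg A X p (\<lambda>f. \<phi> (f a)) = (\<Sum>x\<in>X. p x * \<phi> x)"
proof -
  have "code_avg (insert a (A - {a})) X p (\<lambda>f. \<phi> (f a)) = (\<Sum>x\<in>X. p x * \<phi> x)"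
    using assms is_pmfD[OF assms(2)] by (subst code_avg_insert) (simp_all add: code_avg_const)
  then show ?thesis using assms by (simp add: insert_absorb)
qed

text \<open>Distinct letters receive independent words. This pairwise independence is all that the
  union bound asks of a random codebook.\<close>

lemma code_avg_two:
  assumes "finite A" "is_pmf X p" "a \<in> A" "b \<in> A" "a \<noteq> b"
  shows "code_avg A X p (\<lambda>f. \<phi> (f a) (f b)) = (\<Sum>x\<in>X. p x * (\<Sum>y\<in>X. p y * \<phi> x y))"
proof -
  have "code_avg (insert a (A - {a})) X p (\<lambda>f. \<phi> (f a) (f b)) =
      (\<Sum>x\<in>X. p x * (\<Sum>y\<in>X. p y * \<phi> x y))"
    using assms is_pmfD[OF assms(2)] by (subst code_avg_insert) (simp_all add: code_avg_one)
  then show ?thesis using assms by (simp add: insert_absorb)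
qed

lemma code_avg_mono:
  assumes "is_pmf X p" "\<And>f. f \<in> A \<rightarrow>\<^sub>E X \<Longrightarrow> \<phi> f \<le> \<psi> f"
  shows "code_avg A X p \<phi> \<le> code_avg A X p \<psi>"
  unfolding code_avg_def
  using is_pmfD[OF assms(1)]
  by (intro sum_mono mult_left_mono assms(2) prod_nonneg ballI) (auto intro: PiE_mem)

lemma code_avg_sum:
  "code_avg A X p (\<lambda>f. \<Sum>i\<in>I. \<phi> i f) = (\<Sum>i\<in>I. code_avg A X p (\<phi> i))"
  unfolding code_avg_def sum_distrib_left by (rule sum.swap)

lemma code_avg_add:
  "code_avg A X p (\<lambda>f. \<phi> f + \<psi> f) = code_avg A X p \<phi> + code_avg A X p \<psi>"
  unfolding code_avg_def by (simp add: distrib_left sum.distrib)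

lemma code_avg_swap:
  "code_avg A X p (\<lambda>f. code_avg C V r (\<lambda>g. \<phi> f g)) =
   code_avg C V r (\<lambda>g. code_avg A X p (\<lambda>f. \<phi> f g))"
  unfolding code_avg_def sum_distrib_left
  by (subst sum.swap) (simp add: mult_ac)

lemma code_avg_cong:
  "(\<And>f. f \<in> A \<rightarrow>\<^sub>E X \<Longrightarrow> \<phi> f = \<psi> f) \<Longrightarrow> code_avg A X p \<phi> = code_avg A X p \<psi>"
  unfolding code_avg_def by (intro sum.cong) auto

section \<open>Confusion with independently coded wrong candidates\<close>

lemma code_avg_pairs_le:
  assumes "finite A" "is_pmf X p"
    and nn: "\<And>a x a' x'. a \<in> A \<Longrightarrow> x \<in> X \<Longrightarrow> a' \<in> A \<Longrightarrow> x' \<in> X \<Longrightarrow> 0 \<le> \<phi> a x a' x'"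
  shows "(\<Sum>a\<in>A. \<Sum>a'\<in>A - {a}. code_avg A X p (\<lambda>f. \<phi> a (f a) a' (f a'))) \<le>
    (\<Sum>a\<in>A. \<Sum>a'\<in>A. \<Sum>x\<in>X. \<Sum>x'\<in>X. p x * p x' * \<phi> a x a' x')"
proof (intro sum_mono)
  fix a assume a: "a \<in> A"
  have "(\<Sum>a'\<in>A - {a}. code_avg A X p (\<lambda>f. \<phi> a (f a) a' (f a'))) =
     (\<Sum>a'\<in>A - {a}. \<Sum>x\<in>X. \<Sum>x'\<in>X. p x * p x' * \<phi> a x a' x')"
    using assms(1,2) a
    by (intro sum.cong refl, subst code_avg_two) (auto simp: sum_distrib_left mult.assoc)
  \<comment> \<open>Once independence has been used, the excluded diagonal is put back as
    nonnegative terms, which leaves a full double sum that can factorise.\<close>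
  also have "\<dots> \<le> (\<Sum>a'\<in>A. \<Sum>x\<in>X. \<Sum>x'\<in>X. p x * p x' * \<phi> a x a' x')"
    using assms(1) a nn is_pmfD[OF assms(2)]
    by (intro sum_mono2) (auto intro!: sum_nonneg)
  finally show "(\<Sum>a'\<in>A - {a}. code_avg A X p (\<lambda>f. \<phi> a (f a) a' (f a'))) \<le>
      (\<Sum>a'\<in>A. \<Sum>x\<in>X. \<Sum>x'\<in>X. p x * p x' * \<phi> a x a' x')" .
qed

text \<open>Markov's inequality, kept free of division by \<open>M\<close> so that it also covers \<open>M = 0\<close>.\<close>
lemma markov_weight:
  fixes w K :: "'i \<Rightarrow> real"
  assumes "finite I" "\<And>i. i \<in> I \<Longrightarrow> 0 \<le> w i" "\<And>i. i \<in> I \<Longrightarrow> 0 \<le> K i"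
    and M: "M = (\<Sum>i\<in>I. w i * K i)" and th: "0 < \<theta>"
    and G: "\<And>i. i \<in> I \<Longrightarrow> G i \<Longrightarrow> \<theta> * M \<le> K i"
  shows "M * (\<Sum>i\<in>I. w i * of_bool (G i)) \<le> M / \<theta>"
proof -
  have "\<theta> * (M * (\<Sum>i\<in>I. w i * of_bool (G i))) = (\<Sum>i\<in>I. w i * (\<theta> * M * of_bool (G i)))"
    by (simp add: sum_distrib_left mult_ac)
  also have "\<dots> \<le> (\<Sum>i\<in>I. w i * K i)"
    using assms by (intro sum_mono mult_left_mono) (auto simp: of_bool_def)
  finally have "\<theta> * (M * (\<Sum>i\<in>I. w i * of_bool (G i))) \<le> M" using M by simp
  then show ?thesis using th by (simp add: field_simps)
qed

text \<open>Here \<open>a\<close> is the true letter with weight \<open>K\<close>, and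
  \<open>a'\<close> a wrong one that passes the test \<open>G\<close>. Independence splits the
  double sum into the total weight \<open>M\<close> times the mass of passing pairs, and Markov's
  inequality bounds this product, however many letters \<open>A\<close> has.\<close>

lemma confusion_single:
  assumes "finite A" "is_pmf X p"
    and nn: "\<And>a x. a \<in> A \<Longrightarrow> x \<in> X \<Longrightarrow> 0 \<le> K a x"
    and M: "(\<Sum>a\<in>A. \<Sum>x\<in>X. p x * K a x) = M" and th: "0 < \<theta>"
    and G: "\<And>a x. a \<in> A \<Longrightarrow> x \<in> X \<Longrightarrow> G a x \<Longrightarrow> \<theta> * M \<le> K a x"
  shows "(\<Sum>a\<in>A. \<Sum>a'\<in>A - {a}. code_avg A X p (\<lambda>f. K a (f a) * of_bool (G a' (f a')))) \<le> M / \<theta>"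
proof -
  note X = is_pmfD[OF assms(2)]
  have "(\<Sum>a\<in>A. \<Sum>a'\<in>A - {a}. code_avg A X p (\<lambda>f. K a (f a) * of_bool (G a' (f a')))) \<le>
    (\<Sum>a\<in>A. \<Sum>a'\<in>A. \<Sum>x\<in>X. \<Sum>x'\<in>X. p x * p x' * (K a x * of_bool (G a' x')))"
    using assms(1,2) nn by (intro code_avg_pairs_le) auto
  also have "\<dots> = (\<Sum>a\<in>A. \<Sum>a'\<in>A. (\<Sum>x\<in>X. p x * K a x) * (\<Sum>x'\<in>X. p x' * of_bool (G a' x')))"
    by (simp add: sum_product mult_ac)
  also have "\<dots> = (\<Sum>a\<in>A. \<Sum>x\<in>X. p x * K a x) * (\<Sum>a\<in>A. \<Sum>x\<in>X. p x * of_bool (G a x))"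
    by (simp add: sum_product)
  also have "\<dots> = M * (\<Sum>i\<in>A \<times> X. p (snd i) * of_bool (G (fst i) (snd i)))"
    by (simp only: M) (simp add: sum.cartesian_product case_prod_unfold)
  also have "\<dots> \<le> M / \<theta>"
    using assms X by (intro markov_weight[where K = "\<lambda>i. K (fst i) (snd i)"])
      (auto simp: M[symmetric] sum.cartesian_product case_prod_unfold)
  finally show ?thesis .
qed

text \<open>With the second codebook and the second letter frozen, this is
  \<open>confusion_single\<close> with total weight \<open>M1 c v\<close>; averaging over the second
  codebook turns \<open>M1\<close> into \<open>M0\<close>. Exchanging the roles of the codebooks
  covers a wrong second letter.\<close>

lemma confusion_one_of_two:
  assumes fin: "finite A" "finite C" and pmf: "is_pmf X p" "is_pmf V r"
    and nn: "\<And>a x c v. a \<in> A \<Longrightarrow> x \<in> X \<Longrightarrow> c \<in> C \<Longrightarrow> v \<in> V \<Longrightarrow> 0 \<le> L a x c v"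
    and M1: "\<And>c v. c \<in> C \<Longrightarrow> v \<in> V \<Longrightarrow> (\<Sum>a\<in>A. \<Sum>x\<in>X. p x * L a x c v) = M1 c v"
    and M0: "(\<Sum>c\<in>C. \<Sum>v\<in>V. r v * M1 c v) = M0" and th: "0 < \<theta>"
    and G: "\<And>a x c v. a \<in> A \<Longrightarrow> x \<in> X \<Longrightarrow> c \<in> C \<Longrightarrow> v \<in> V \<Longrightarrow> G a x c v \<Longrightarrow> \<theta> * M1 c v \<le> L a x c v"
  shows "code_avg C V r (\<lambda>g. code_avg A X p (\<lambda>f. \<Sum>c\<in>C. \<Sum>a\<in>A. \<Sum>a'\<in>A - {a}.
      L a (f a) c (g c) * of_bool (G a' (f a') c (g c)))) \<le> M0 / \<theta>"
proof -
  have "code_avg C V r (\<lambda>g. code_avg A X p (\<lambda>f. \<Sum>c\<in>C. \<Sum>a\<in>A. \<Sum>a'\<in>A - {a}.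
      L a (f a) c (g c) * of_bool (G a' (f a') c (g c)))) \<le>
    code_avg C V r (\<lambda>g. \<Sum>c\<in>C. M1 c (g c) / \<theta>)"
  proof (rule code_avg_mono[OF pmf(2)])
    fix g assume g: "g \<in> C \<rightarrow>\<^sub>E V"
    have "(\<Sum>a\<in>A. \<Sum>a'\<in>A - {a}. code_avg A X p (\<lambda>f. L a (f a) c (g c) * of_bool (G a' (f a') c (g c))))
       \<le> M1 c (g c) / \<theta>" if c: "c \<in> C" for c
      using fin pmf nn M1 th G c PiE_mem[OF g c] by (intro confusion_single) auto
    then show "code_avg A X p (\<lambda>f. \<Sum>c\<in>C. \<Sum>a\<in>A. \<Sum>a'\<in>A - {a}.
      L a (f a) c (g c) * of_bool (G a' (f a') c (g c))) \<le> (\<Sum>c\<in>C. M1 c (g c) / \<theta>)"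
      by (simp add: code_avg_sum sum_mono)
  qed
  also have "\<dots> = (\<Sum>c\<in>C. \<Sum>v\<in>V. r v * (M1 c v / \<theta>))"
    unfolding code_avg_sum
    using fin pmf by (intro sum.cong refl code_avg_one[where \<phi> = "\<lambda>v. M1 _ v / \<theta>"]) auto
  also have "\<dots> = M0 / \<theta>"
    by (simp add: M0[symmetric] sum_divide_distrib)
  finally show ?thesis .
qed

text \<open>When both letters are wrong, both candidate words are independent of the true ones, so
  the reference weight is the full total \<open>M0\<close>. The codebooks are averaged one after the
  other, each by the pairwise estimate.\<close>

lemma confusion_both:
  assumes fin: "finite A" "finite C" and pmf: "is_pmf X p" "is_pmf V r"
    and nn: "\<And>a x c v. a \<in> A \<Longrightarrow> x \<in> X \<Longrightarrow> c \<in> C \<Longrightarrow> v \<in> V \<Longrightarrow> 0 \<le> L a x c v"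
    and M0: "(\<Sum>a\<in>A. \<Sum>x\<in>X. \<Sum>c\<in>C. \<Sum>v\<in>V. p x * r v * L a x c v) = M0" and th: "0 < \<theta>"
    and G: "\<And>a x c v. a \<in> A \<Longrightarrow> x \<in> X \<Longrightarrow> c \<in> C \<Longrightarrow> v \<in> V \<Longrightarrow> G a x c v \<Longrightarrow> \<theta> * M0 \<le> L a x c v"
  shows "code_avg A X p (\<lambda>f. code_avg C V r (\<lambda>g. \<Sum>a\<in>A. \<Sum>a'\<in>A - {a}. \<Sum>c\<in>C. \<Sum>c'\<in>C - {c}.
      L a (f a) c (g c) * of_bool (G a' (f a') c' (g c')))) \<le> M0 / \<theta>"
proof -
  note X = is_pmfD[OF pmf(1)] and V = is_pmfD[OF pmf(2)]
  let ?H = "\<lambda>a x a' x'. \<Sum>c\<in>C. \<Sum>c'\<in>C. \<Sum>v\<in>V. \<Sum>v'\<in>V. r v * r v' * (L a x c v * of_bool (G a' x' c' v'))"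
  have "code_avg A X p (\<lambda>f. code_avg C V r (\<lambda>g. \<Sum>a\<in>A. \<Sum>a'\<in>A - {a}. \<Sum>c\<in>C. \<Sum>c'\<in>C - {c}.
      L a (f a) c (g c) * of_bool (G a' (f a') c' (g c')))) \<le>
     code_avg A X p (\<lambda>f. \<Sum>a\<in>A. \<Sum>a'\<in>A - {a}. ?H a (f a) a' (f a'))"
  proof (rule code_avg_mono[OF pmf(1)])
    fix f assume f: "f \<in> A \<rightarrow>\<^sub>E X"
    have "(\<Sum>c\<in>C. \<Sum>c'\<in>C - {c}. code_avg C V r (\<lambda>g. L a (f a) c (g c) * of_bool (G a' (f a') c' (g c'))))
        \<le> ?H a (f a) a' (f a')" if "a \<in> A" for a a'
      using fin(2) pmf(2) nn that PiE_mem[OF f that] by (intro code_avg_pairs_le) auto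
    then show "code_avg C V r (\<lambda>g. \<Sum>a\<in>A. \<Sum>a'\<in>A - {a}. \<Sum>c\<in>C. \<Sum>c'\<in>C - {c}.
        L a (f a) c (g c) * of_bool (G a' (f a') c' (g c'))) \<le> (\<Sum>a\<in>A. \<Sum>a'\<in>A - {a}. ?H a (f a) a' (f a'))"
      by (simp add: code_avg_sum sum_mono)
  qed
  also have "\<dots> = (\<Sum>a\<in>A. \<Sum>a'\<in>A - {a}. code_avg A X p (\<lambda>f. ?H a (f a) a' (f a')))"
    by (simp only: code_avg_sum)
  also have "\<dots> \<le> (\<Sum>a\<in>A. \<Sum>a'\<in>A. \<Sum>x\<in>X. \<Sum>x'\<in>X. p x * p x' * ?H a x a' x')"
    using nn V by (intro code_avg_pairs_le[OF fin(1) pmf(1)] sum_nonneg mult_nonneg_nonneg) auto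
  \<comment> \<open>The test involves only the primed letters and the weight only the unprimed ones,
    so the sum becomes a product of two sums.\<close>
  also have "\<dots> = (\<Sum>a\<in>A. \<Sum>a'\<in>A. \<Sum>x\<in>X. \<Sum>x'\<in>X. 
      (\<Sum>c\<in>C. \<Sum>v\<in>V. p x * r v * L a x c v) * (\<Sum>c\<in>C. \<Sum>v\<in>V. p x' * r v * of_bool (G a' x' c v)))"
    by (simp only: sum_product) (simp only: sum_distrib_left mult_ac)
  also have "\<dots> = (\<Sum>a\<in>A. \<Sum>x\<in>X. \<Sum>c\<in>C. \<Sum>v\<in>V. p x * r v * L a x c v) *
      (\<Sum>a\<in>A. \<Sum>x\<in>X. \<Sum>c\<in>C. \<Sum>v\<in>V. p x * r v * of_bool (G a x c v))"
    by (simp only: sum_product)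
  also have "\<dots> = M0 * (\<Sum>i\<in>A \<times> X \<times> C \<times> V. (p (fst (snd i)) * r (snd (snd (snd i)))) *
      of_bool (G (fst i) (fst (snd i)) (fst (snd (snd i))) (snd (snd (snd i)))))"
    by (simp only: M0) (simp add: sum.cartesian_product case_prod_unfold)
  also have "\<dots> \<le> M0 / \<theta>"
    using fin X V nn th G
    by (intro markov_weight[where K = "\<lambda>i. L (fst i) (fst (snd i)) (fst (snd (snd i))) (snd (snd (snd i)))"])
      (auto simp: M0[symmetric] sum.cartesian_product case_prod_unfold)
  finally show ?thesis .
qed

section \<open>The threshold decoder and its union bound\<close>

definition threshold_decoder ::
  "'a set \<Rightarrow> 'c set \<Rightarrow> ('a \<Rightarrow> 'x \<Rightarrow> 'c \<Rightarrow> 'v \<Rightarrow> bool) \<Rightarrow> ('a \<Rightarrow> 'x) \<Rightarrow> ('c \<Rightarrow> 'v) \<Rightarrow> 'a \<times> 'c" where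
  "threshold_decoder A C G f g =
    (SOME u. fst u \<in> A \<and> snd u \<in> C \<and> G (fst u) (f (fst u)) (snd u) (g (snd u)))"

text \<open>As soon as some pair passes, the output passes too, whichever pair \<open>SOME\<close>
  picks. Hence an error means that the true pair fails, or that a passing pair differs from it in
  the first letter, the second, or both. If no pair passes, the first term pays for the arbitrary
  output.\<close>

lemma threshold_decoder_error:
  assumes "finite A" "finite C" "a \<in> A" "c \<in> C"
  shows "of_bool (threshold_decoder A C G f g \<noteq> (a, c)) \<le>
    (of_bool (\<not> G a (f a) c (g c)) + (\<Sum>a'\<in>A - {a}. of_bool (G a' (f a') c (g c))) +
     (\<Sum>c'\<in>C - {c}. of_bool (G a (f a) c' (g c'))) +
     (\<Sum>a'\<in>A - {a}. \<Sum>c'\<in>C - {c}. of_bool (G a' (f a') c' (g c'))) :: real)"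
    (is "_ \<le> ?R0 + ?R1 + ?R2 + ?R3")
proof (cases "threshold_decoder A C G f g = (a, c) \<or> \<not> G a (f a) c (g c)")
  case True
  have "0 \<le> ?R1" "0 \<le> ?R2" "0 \<le> ?R3" by (auto intro!: sum_nonneg)
  then show ?thesis using True by auto
next
  case False
  obtain a' c' where u: "threshold_decoder A C G f g = (a', c')" by fastforce
  have "fst (threshold_decoder A C G f g) \<in> A \<and> snd (threshold_decoder A C G f g) \<in> C \<and>
     G (fst (threshold_decoder A C G f g)) (f (fst (threshold_decoder A C G f g)))
       (snd (threshold_decoder A C G f g)) (g (snd (threshold_decoder A C G f g)))"
    unfolding threshold_decoder_def by (rule someI[of _ "(a, c)"]) (use False assms in auto)
  then have G: "a' \<in> A" "c' \<in> C" "G a' (f a') c' (g c')" using u by auto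
  have nn: "0 \<le> ?R0" "0 \<le> ?R1" "0 \<le> ?R2" "0 \<le> ?R3" by (auto intro!: sum_nonneg)
  consider "a' \<noteq> a" "c' = c" | "a' = a" "c' \<noteq> c" | "a' \<noteq> a" "c' \<noteq> c" using False u by auto
  then have "1 \<le> ?R1 \<or> 1 \<le> ?R2 \<or> 1 \<le> ?R3"
  proof cases
    case 1
    then have "of_bool (G a' (f a') c (g c)) \<le> ?R1"
      using G assms by (intro member_le_sum[where f = "\<lambda>a'. of_bool (G a' (f a') c (g c))"]) auto
    then show ?thesis using 1 G by auto
  next
    case 2
    then have "of_bool (G a (f a) c' (g c')) \<le> ?R2"
      using G assms by (intro member_le_sum[where f = "\<lambda>c'. of_bool (G a (f a) c' (g c'))"]) auto
    then show ?thesis using 2 G by auto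
  next
    case 3
    have "of_bool (G a' (f a') c' (g c')) \<le> (\<Sum>c'\<in>C - {c}. of_bool (G a' (f a') c' (g c')) :: real)"
      using G assms 3 by (intro member_le_sum[where f = "\<lambda>c'. of_bool (G a' (f a') c' (g c'))"]) auto
    also have "\<dots> \<le> ?R3"
      using G assms 3 by (intro member_le_sum[where f = "\<lambda>a'. \<Sum>c'\<in>C - {c}. of_bool (G a' (f a') c' (g c'))"])
        (auto intro!: sum_nonneg)
    finally show ?thesis using G by auto
  qed
  then show ?thesis using nn by (auto simp: of_bool_def split: if_splits)
qed

text \<open>\<open>L\<close> belongs to one fixed observation of the receiver, so its total
  \<open>M0\<close> is the weight of that observation and need not be 1; the confusion term is
  proportional to it and can later be summed over observations. Each confusion estimate uses just
  the conjunct of \<open>G\<close> that matches the wrong letters.\<close>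

lemma random_code_error:
  assumes fin: "finite A" "finite C" and pmf: "is_pmf X p" "is_pmf V r"
    and nn: "\<And>a x c v. a \<in> A \<Longrightarrow> x \<in> X \<Longrightarrow> c \<in> C \<Longrightarrow> v \<in> V \<Longrightarrow> 0 \<le> L a x c v"
    and M1: "\<And>c v. c \<in> C \<Longrightarrow> v \<in> V \<Longrightarrow> (\<Sum>a\<in>A. \<Sum>x\<in>X. p x * L a x c v) = M1 c v"
    and M2: "\<And>a x. a \<in> A \<Longrightarrow> x \<in> X \<Longrightarrow> (\<Sum>c\<in>C. \<Sum>v\<in>V. r v * L a x c v) = M2 a x"
    and M01: "(\<Sum>c\<in>C. \<Sum>v\<in>V. r v * M1 c v) = M0"
    and M02: "(\<Sum>a\<in>A. \<Sum>x\<in>X. p x * M2 a x) = M0" and th: "0 < \<theta>"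
    and G: "\<And>a x c v. a \<in> A \<Longrightarrow> x \<in> X \<Longrightarrow> c \<in> C \<Longrightarrow> v \<in> V \<Longrightarrow>
      G a x c v \<longleftrightarrow> \<theta> * M1 c v \<le> L a x c v \<and> \<theta> * M2 a x \<le> L a x c v \<and> \<theta> * M0 \<le> L a x c v"
  shows "code_avg A X p (\<lambda>f. code_avg C V r (\<lambda>g. \<Sum>a\<in>A. \<Sum>c\<in>C.
      L a (f a) c (g c) * of_bool (threshold_decoder A C G f g \<noteq> (a, c)))) \<le>
    (\<Sum>a\<in>A. \<Sum>c\<in>C. \<Sum>x\<in>X. \<Sum>v\<in>V. p x * r v * (L a x c v * of_bool (\<not> G a x c v))) + 3 * M0 / \<theta>"
proof -
  let ?T0 = "\<lambda>f g. \<Sum>a\<in>A. \<Sum>c\<in>C. L a (f a) c (g c) * of_bool (\<not> G a (f a) c (g c))"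
  let ?T1 = "\<lambda>f g. \<Sum>c\<in>C. \<Sum>a\<in>A. \<Sum>a'\<in>A - {a}. L a (f a) c (g c) * of_bool (G a' (f a') c (g c))"
  let ?T2 = "\<lambda>f g. \<Sum>a\<in>A. \<Sum>c\<in>C. \<Sum>c'\<in>C - {c}. L a (f a) c (g c) * of_bool (G a (f a) c' (g c'))"
  let ?T3 = "\<lambda>f g. \<Sum>a\<in>A. \<Sum>a'\<in>A - {a}. \<Sum>c\<in>C. \<Sum>c'\<in>C - {c}.
      L a (f a) c (g c) * of_bool (G a' (f a') c' (g c'))"
  let ?E = "\<lambda>T. code_avg A X p (\<lambda>f. code_avg C V r (\<lambda>g. T f g))"
  have "?E (\<lambda>f g. \<Sum>a\<in>A. \<Sum>c\<in>C. L a (f a) c (g c) * of_bool (threshold_decoder A C G f g \<noteq> (a, c))) \<le>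
     ?E (\<lambda>f g. ?T0 f g + ?T1 f g + ?T2 f g + ?T3 f g)"
  proof (intro code_avg_mono[OF pmf(1)] code_avg_mono[OF pmf(2)])
    fix f g assume f: "f \<in> A \<rightarrow>\<^sub>E X" and g: "g \<in> C \<rightarrow>\<^sub>E V"
    have "(\<Sum>a\<in>A. \<Sum>c\<in>C. L a (f a) c (g c) * of_bool (threshold_decoder A C G f g \<noteq> (a, c))) \<le>
      (\<Sum>a\<in>A. \<Sum>c\<in>C. L a (f a) c (g c) *
         (of_bool (\<not> G a (f a) c (g c)) + (\<Sum>a'\<in>A - {a}. of_bool (G a' (f a') c (g c))) +
     (\<Sum>c'\<in>C - {c}. of_bool (G a (f a) c' (g c'))) +
     (\<Sum>a'\<in>A - {a}. \<Sum>c'\<in>C - {c}. of_bool (G a' (f a') c' (g c')))))"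
      using fin by (intro sum_mono mult_left_mono threshold_decoder_error)
        (auto intro!: nn PiE_mem[OF f] PiE_mem[OF g])
    also have "\<dots> = ?T0 f g + (\<Sum>a\<in>A. \<Sum>c\<in>C. \<Sum>a'\<in>A - {a}. L a (f a) c (g c) * of_bool (G a' (f a') c (g c))) +
        ?T2 f g + (\<Sum>a\<in>A. \<Sum>c\<in>C. \<Sum>a'\<in>A - {a}. \<Sum>c'\<in>C - {c}.
      L a (f a) c (g c) * of_bool (G a' (f a') c' (g c')))"
      by (simp only: distrib_left sum.distrib sum_distrib_left)
    also have "(\<Sum>a\<in>A. \<Sum>c\<in>C. \<Sum>a'\<in>A - {a}. L a (f a) c (g c) * of_bool (G a' (f a') c (g c))) = ?T1 f g"
      by (rule sum.swap)
    also have "(\<Sum>a\<in>A. \<Sum>c\<in>C. \<Sum>a'\<in>A - {a}. \<Sum>c'\<in>C - {c}.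
      L a (f a) c (g c) * of_bool (G a' (f a') c' (g c'))) = ?T3 f g"
      by (intro sum.cong refl sum.swap)
    finally show "(\<Sum>a\<in>A. \<Sum>c\<in>C. L a (f a) c (g c) * of_bool (threshold_decoder A C G f g \<noteq> (a, c))) \<le>
       ?T0 f g + ?T1 f g + ?T2 f g + ?T3 f g" .
  qed
  also have "\<dots> = ?E ?T0 + ?E ?T1 + ?E ?T2 + ?E ?T3"
    by (simp only: code_avg_add)
  also have "?E ?T0 = (\<Sum>a\<in>A. \<Sum>c\<in>C. \<Sum>x\<in>X. \<Sum>v\<in>V. p x * r v * (L a x c v * of_bool (\<not> G a x c v)))"
  proof -
    have "code_avg A X p (\<lambda>f. code_avg C V r (\<lambda>g. L a (f a) c (g c) * of_bool (\<not> G a (f a) c (g c)))) =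
      (\<Sum>x\<in>X. \<Sum>v\<in>V. p x * r v * (L a x c v * of_bool (\<not> G a x c v)))" if "a \<in> A" "c \<in> C" for a c
    proof -
      have "code_avg A X p (\<lambda>f. code_avg C V r (\<lambda>g. L a (f a) c (g c) * of_bool (\<not> G a (f a) c (g c)))) =
        code_avg A X p (\<lambda>f. \<Sum>v\<in>V. r v * (L a (f a) c v * of_bool (\<not> G a (f a) c v)))"
        using that fin pmf by (intro code_avg_cong code_avg_one) auto
      also have "\<dots> = (\<Sum>x\<in>X. p x * (\<Sum>v\<in>V. r v * (L a x c v * of_bool (\<not> G a x c v))))"
        by (rule code_avg_one[OF fin(1) pmf(1) that(1)])
      finally show ?thesis by (simp add: sum_distrib_left mult.assoc)
    qed
    then show ?thesis by (simp add: code_avg_sum)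
  qed
  also have "?E ?T1 \<le> M0 / \<theta>"
    \<comment> \<open>\<open>confusion_one_of_two\<close> wants the average over the confused
      codebook innermost; for the second codebook it already is.\<close>
    unfolding code_avg_swap[of A]
    using fin pmf nn M1 M01 th G by (intro confusion_one_of_two) auto
  also have "?E ?T2 \<le> M0 / \<theta>"
    using fin pmf nn M2 M02 th G
    by (intro confusion_one_of_two[where L = "\<lambda>c v a x. L a x c v" and G = "\<lambda>c v a x. G a x c v"]) auto
  also have "?E ?T3 \<le> M0 / \<theta>"
  proof (rule confusion_both[OF fin pmf nn _ th])
    have "M0 = (\<Sum>a\<in>A. \<Sum>x\<in>X. p x * (\<Sum>c\<in>C. \<Sum>v\<in>V. r v * L a x c v))"
      using M02 M2 by simp
    then show "(\<Sum>a\<in>A. \<Sum>x\<in>X. \<Sum>c\<in>C. \<Sum>v\<in>V. p x * r v * L a x c v) = M0"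
      by (simp add: sum_distrib_left mult.assoc)
  qed (use G in auto)
  finally show ?thesis by simp
qed

section \<open>Words and the Chernoff bound\<close>

text \<open>Stands beside \<open>seqs\<close>, which takes letters from a whole type: time-sharing
  words use letters of a finite set \<open>Q\<close>, possibly inside an infinite type.\<close>

definition words :: "'a set \<Rightarrow> nat \<Rightarrow> 'a list set" where
  "words A n = {xs. length xs = n \<and> set xs \<subseteq> A}"

lemma seqs_eq_words: "seqs n = words UNIV n"
  by (simp add: seqs_def words_def)

lemma words_0: "words A 0 = {[]}"
  by (auto simp: words_def)

lemma words_Suc: "words A (Suc n) = (\<lambda>(x, xs). x # xs) ` (A \<times> words A n)"
  by (auto simp: words_def length_Suc_conv image_iff)

lemma finite_words: "finite A \<Longrightarrow> finite (words A n)"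
  by (induction n) (simp_all add: words_0 words_Suc)

lemma finite_seqs: "finite (seqs n :: 'a::finite list set)"
  by (simp add: seqs_eq_words finite_words)

lemma nth_words: "xs \<in> words A n \<Longrightarrow> j < n \<Longrightarrow> xs ! j \<in> A"
  by (auto simp: words_def)

text \<open>The distributive law. The factors may depend on the position because they usually
  contain letters of other words at the same index.\<close>

lemma sum_words_prod:
  fixes h :: "nat \<Rightarrow> 'a \<Rightarrow> real"
  shows "(\<Sum>xs\<in>words A n. \<Prod>j<n. h j (xs ! j)) = (\<Prod>j<n. \<Sum>x\<in>A. h j x)"
proof (induction n arbitrary: h)
  case 0
  then show ?case by (simp add: words_0)
next
  case (Suc n)
  have "inj_on (\<lambda>(x, xs). x # xs) (A \<times> words A n)" by (auto simp: inj_on_def)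
  then have "(\<Sum>xs\<in>words A (Suc n). \<Prod>j<Suc n. h j (xs ! j)) =
      (\<Sum>(x, xs)\<in>A \<times> words A n. \<Prod>j<Suc n. h j ((x # xs) ! j))"
    unfolding words_Suc by (subst sum.reindex) (simp_all add: case_prod_unfold)
  also have "\<dots> = (\<Sum>x\<in>A. h 0 x * (\<Sum>xs\<in>words A n. \<Prod>j<n. h (Suc j) (xs ! j)))"
    by (simp only: prod.lessThan_Suc_shift) (simp add: sum.cartesian_product sum_distrib_left)
  also have "\<dots> = (\<Prod>j<Suc n. \<Sum>x\<in>A. h j x)"
    by (simp only: prod.lessThan_Suc_shift Suc.IH[of "\<lambda>j. h (Suc j)"]) (simp add: sum_distrib_right)
  finally show ?case .
qed

lemmas sum_seqs_prod = sum_words_prod[where A = UNIV, folded seqs_eq_words]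

lemma is_pmf_words:
  assumes "\<And>j. j < n \<Longrightarrow> is_pmf A (p j)" "finite A"
  shows "is_pmf (words A n) (\<lambda>xs. \<Prod>j<n. p j (xs ! j))"
  using assms
  by (auto simp: is_pmf_def finite_words sum_words_prod intro!: prod_nonneg nth_words)

section \<open>Reindexing and marginalising sums over words\<close>

lemma sum_seqs_zip:
  "(\<Sum>u\<in>seqs m. F u) = (\<Sum>a\<in>seqs m. \<Sum>b\<in>seqs m. F (zip a b))"
  unfolding sum.cartesian_product
  by (rule sum.reindex_bij_witness[of _ "\<lambda>(a, b). zip a b" "\<lambda>u. (map fst u, map snd u)"])
    (auto simp: seqs_def zip_map_fst_snd)

text \<open>When the rest of the summand sees only the letterwise image, the product weight can be
  summed over the fibres of \<pi> position by position: the image of a product law is a product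
  law.\<close>

lemma sum_seqs_map:
  fixes h :: "nat \<Rightarrow> 'a::finite \<Rightarrow> real" and \<pi> :: "'a \<Rightarrow> 'b::finite"
  shows "(\<Sum>a\<in>seqs m. (\<Prod>i<m. h i (a ! i)) * G (map \<pi> a)) =
    (\<Sum>b\<in>seqs m. (\<Prod>i<m. \<Sum>a\<in>UNIV. if \<pi> a = b ! i then h i a else 0) * G b)"
proof -
  \<comment> \<open>The indicators at the positions multiply to the indicator that the whole words
    agree, since a mismatch anywhere makes one factor vanish.\<close>
  have "(\<Prod>i<m. if \<pi> (a ! i) = b ! i then h i (a ! i) else 0) =
      (if map \<pi> a = b then \<Prod>i<m. h i (a ! i) else 0)" if "a \<in> seqs m" "b \<in> seqs m" for a b
  proof (cases "map \<pi> a = b")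
    case True
    then show ?thesis using that by (auto simp: seqs_def intro!: prod.cong)
  next
    case False
    then have "\<exists>i<m. \<pi> (a ! i) \<noteq> b ! i"
      using that nth_equalityI[of "map \<pi> a" b] by (auto simp: seqs_def)
    then show ?thesis using False by (auto intro!: prod_zero)
  qed
  then have "(\<Sum>b\<in>seqs m. (\<Prod>i<m. \<Sum>a\<in>UNIV. if \<pi> a = b ! i then h i a else 0) * G b) =
    (\<Sum>b\<in>seqs m. (\<Sum>a\<in>seqs m. if map \<pi> a = b then \<Prod>i<m. h i (a ! i) else 0) * G b)"
    by (simp add: sum_seqs_prod[symmetric])
  also have "\<dots> = (\<Sum>a\<in>seqs m. \<Sum>b\<in>seqs m. if map \<pi> a = b then (\<Prod>i<m. h i (a ! i)) * G b else 0)"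
    unfolding sum_distrib_right by (subst sum.swap) (simp add: if_distrib if_distribR cong: if_cong)
  also have "\<dots> = (\<Sum>a\<in>seqs m. (\<Prod>i<m. h i (a ! i)) * G (map \<pi> a))"
    by (intro sum.cong refl) (simp add: finite_seqs, simp add: seqs_def)
  finally show ?thesis by simp
qed

section \<open>Exponential tilting and the tail of the likelihood ratio\<close>

lemma has_derivative_tilt:
  fixes P r :: "'i \<Rightarrow> real"
  assumes "finite I" and r: "\<And>i. i \<in> I \<Longrightarrow> P i \<noteq> 0 \<Longrightarrow> 0 < r i"
  shows "((\<lambda>l. \<Sum>i\<in>I. P i * r i powr l) has_real_derivative (\<Sum>i\<in>I. P i * ln (r i))) (at 0)"
proof (rule DERIV_sum)
  fix i assume i: "i \<in> I"
  show "((\<lambda>l. P i * r i powr l) has_real_derivative P i * ln (r i)) (at 0)"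
  proof (cases "P i = 0")
    case False
    have "((\<lambda>l. P i * exp (l * ln (r i))) has_real_derivative P i * ln (r i)) (at 0)"
      by (auto intro!: derivative_eq_intros)
    then show ?thesis using r[OF i False] by (simp add: powr_def)
  qed simp
qed

text \<open>The product in the conclusion equals 1 at \<open>x = 0\<close>, and its derivative there
  is the left-hand side of \<open>gap\<close>; being negative, it pushes the product below 1 just to
  the right of 0.\<close>

lemma chernoff_exponent:
  fixes P r :: "'i \<Rightarrow> real" and R s :: "'j \<Rightarrow> real"
  assumes P: "is_pmf I P" "\<And>i. i \<in> I \<Longrightarrow> P i \<noteq> 0 \<Longrightarrow> 0 < r i"
    and R: "is_pmf J R" "\<And>j. j \<in> J \<Longrightarrow> R j \<noteq> 0 \<Longrightarrow> 0 < s j"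
    and gap: "real k * (\<Sum>i\<in>I. P i * ln (r i)) + real l * (\<Sum>j\<in>J. R j * ln (s j)) + c < 0"
  obtains x where "0 < x"
    "exp (c * x) * (\<Sum>i\<in>I. P i * r i powr x) ^ k * (\<Sum>j\<in>J. R j * s j powr x) ^ l < 1"
proof -
  note PD = is_pmfD[OF P(1)] and RD = is_pmfD[OF R(1)]
  let ?A = "\<lambda>x. \<Sum>i\<in>I. P i * r i powr x" and ?B = "\<lambda>x. \<Sum>j\<in>J. R j * s j powr x"
  let ?F = "\<lambda>x. exp (c * x) * ?A x ^ k * ?B x ^ l"
  \<comment> \<open>In HOL \<open>0 powr 0\<close> is 0, so the value 1 relies on the ratio being
    positive wherever the probability is not 0.\<close>
  have one: "(\<Sum>i\<in>I. P i * r i powr 0) = 1" 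
  proof -
    have "(\<Sum>i\<in>I. P i * r i powr 0) = sum P I" using P(2) by (intro sum.cong) force+
    then show ?thesis using PD by simp
  qed
  have one': "(\<Sum>j\<in>J. R j * s j powr 0) = 1" 
  proof -
    have "(\<Sum>j\<in>J. R j * s j powr 0) = sum R J" using R(2) by (intro sum.cong) force+
    then show ?thesis using RD by simp
  qed
  have dA: "(?A has_real_derivative (\<Sum>i\<in>I. P i * ln (r i))) (at 0)"
    using PD P by (intro has_derivative_tilt)
  have dB: "(?B has_real_derivative (\<Sum>j\<in>J. R j * ln (s j))) (at 0)"
    using RD R by (intro has_derivative_tilt)
  have "(?F has_real_derivative
      (real k * (\<Sum>i\<in>I. P i * ln (r i)) + real l * (\<Sum>j\<in>J. R j * ln (s j)) + c)) (at 0)"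
    by (rule derivative_eq_intros dA dB refl)+ (simp only: one one', simp)
  from DERIV_neg_dec_right[OF this gap] obtain d where d: "0 < d" "\<And>h. 0 < h \<Longrightarrow> h < d \<Longrightarrow> ?F (0 + h) < ?F 0"
    by blast
  have "?F 0 = 1" by (simp only: one one') simp
  with d(2)[of "d/2"] d(1) show thesis by (intro that[of "d/2"]) auto
qed

text \<open>Where \<open>L < \<theta> * M\<close> with \<open>L\<close> positive, the quotient
  \<open>\<theta> * M / L\<close> exceeds 1, and so does its positive power. The factor
  \<open>L\<close> on both sides takes care of \<open>L = 0\<close>.\<close>

lemma tilt_bound:
  fixes L M \<theta> x :: real
  assumes "0 \<le> L" "0 < \<theta>" "0 < x"
  shows "L * of_bool (L < \<theta> * M) \<le> L * (\<theta> powr x * (M / L) powr x)"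
proof (cases "L = 0 \<or> \<not> L < \<theta> * M")
  case False
  then have "1 \<le> \<theta> * M / L" using assms by (simp add: field_simps)
  then have "1 \<le> (\<theta> * (M / L)) powr x" using assms by (simp add: ge_one_powr_ge_zero)
  then have "1 \<le> \<theta> powr x * (M / L) powr x" by (simp only: powr_mult)
  from mult_left_mono[OF this assms(1)] show ?thesis using False by simp
qed (use assms in auto)

text \<open>The probability, given the time-sharing word \<open>qs\<close>, that the true words and
  the observation have joint weight below \<open>\<theta>\<close> times a reference weight.
  \<open>M\<close> and \<open>N\<close> take all letters, although each marginal ignores some, so
  that the three tests are instances of one expression.\<close>

definition tail_prob ::
  "('s::finite \<Rightarrow> 't::finite \<Rightarrow> 'w::finite \<Rightarrow> real) \<Rightarrow> ('x::finite \<Rightarrow> 'v::finite \<Rightarrow> 'y::finite \<Rightarrow> real) \<Rightarrow>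
   ('s \<Rightarrow> 't \<Rightarrow> 'w \<Rightarrow> real) \<Rightarrow> ('q \<Rightarrow> 'x \<Rightarrow> 'v \<Rightarrow> 'y \<Rightarrow> real) \<Rightarrow> ('q \<Rightarrow> 'x \<Rightarrow> real) \<Rightarrow> ('q \<Rightarrow> 'v \<Rightarrow> real) \<Rightarrow>
   nat \<Rightarrow> nat \<Rightarrow> real \<Rightarrow> 'q list \<Rightarrow> real" where
  "tail_prob P V M N p r m n \<theta> qs =
       (\<Sum>ws\<in>seqs m. \<Sum>ys\<in>seqs n. \<Sum>ss\<in>seqs m. \<Sum>ts\<in>seqs m. \<Sum>xs\<in>seqs n. \<Sum>vs\<in>seqs n.
         (\<Prod>j<n. p (qs ! j) (xs ! j)) * (\<Prod>j<n. r (qs ! j) (vs ! j)) *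
         ((\<Prod>i<m. P (ss ! i) (ts ! i) (ws ! i)) * (\<Prod>j<n. V (xs ! j) (vs ! j) (ys ! j)) *
           of_bool ((\<Prod>i<m. P (ss ! i) (ts ! i) (ws ! i)) * (\<Prod>j<n. V (xs ! j) (vs ! j) (ys ! j)) <
             \<theta> *
             ((\<Prod>i<m. M (ss ! i) (ts ! i) (ws ! i)) * (\<Prod>j<n. N (qs ! j) (xs ! j) (vs ! j) (ys ! j))))))"

text \<open>Positions are independent, so after \<open>tilt_bound\<close> the sum factorises into
  \<open>m\<close> equal source factors and \<open>n\<close> equal channel factors, the latter
  including the average over the time-sharing letter. For \<open>m = k * \<tau>\<close> and
  \<open>n = l * \<tau>\<close> this is a \<tau>-th power, and \<open>chernoff_exponent\<close>
  supplies a tilt for which the base is below 1.\<close>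

lemma tail_bound:
  fixes P M :: "'s::finite \<Rightarrow> 't::finite \<Rightarrow> 'w::finite \<Rightarrow> real"
    and V :: "'x::finite \<Rightarrow> 'v::finite \<Rightarrow> 'y::finite \<Rightarrow> real" and N :: "'q \<Rightarrow> 'x \<Rightarrow> 'v \<Rightarrow> 'y \<Rightarrow> real"
    and Q :: "'q set" and pq :: "'q \<Rightarrow> real" and p :: "'q \<Rightarrow> 'x \<Rightarrow> real" and r :: "'q \<Rightarrow> 'v \<Rightarrow> real"
  assumes P0: "\<And>s t w. 0 \<le> P s t w" and P1: "(\<Sum>w\<in>UNIV. \<Sum>s\<in>UNIV. \<Sum>t\<in>UNIV. P s t w) = 1"
    and M: "\<And>s t w. P s t w \<noteq> 0 \<Longrightarrow> 0 < M s t w"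
    and V0: "\<And>x v y. 0 \<le> V x v y" and V1: "\<And>x v. (\<Sum>y\<in>UNIV. V x v y) = 1"
    and pq: "is_pmf Q pq" and p: "\<And>q. q \<in> Q \<Longrightarrow> is_pmf UNIV (p q)" and r: "\<And>q. q \<in> Q \<Longrightarrow> is_pmf UNIV (r q)"
    and N: "\<And>q x v y. q \<in> Q \<Longrightarrow> pq q * p q x * r q v * V x v y \<noteq> 0 \<Longrightarrow> 0 < N q x v y"
    and gap: "real k * (\<Sum>w\<in>UNIV. \<Sum>s\<in>UNIV. \<Sum>t\<in>UNIV. P s t w * ln (M s t w / P s t w)) +
      real l * (\<Sum>q\<in>Q. \<Sum>y\<in>UNIV. \<Sum>x\<in>UNIV. \<Sum>v\<in>UNIV. pq q * p q x * r q v * V x v y * ln (N q x v y / V x v y))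
      + c < 0"
  obtains \<rho> where "0 \<le> \<rho>" "\<rho> < 1"
    "\<And>\<tau> m n. m = k * \<tau> \<Longrightarrow> n = l * \<tau> \<Longrightarrow>
      (\<Sum>qs\<in>words Q n. (\<Prod>j<n. pq (qs ! j)) * 
       tail_prob P V M N p r m n (exp (c * real \<tau>)) qs)
      \<le> \<rho> ^ \<tau>"
proof -
  let ?I = "UNIV :: ('w \<times> 's \<times> 't) set" and ?J = "Q \<times> (UNIV :: ('y \<times> 'x \<times> 'v) set)"
  let ?P = "\<lambda>(w, s, t). P s t w" and ?m = "\<lambda>(w, s, t). M s t w / P s t w"
  let ?R = "\<lambda>(q, y, x, v). pq q * p q x * r q v * V x v y" and ?n = "\<lambda>(q, y, x, v). N q x v y / V x v y"
  note pqD = is_pmfD[OF pq] and pD = is_pmfD[OF p] and rD = is_pmfD[OF r]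
  have sumI: "(\<Sum>i\<in>?I. f i) = (\<Sum>w\<in>UNIV. \<Sum>s\<in>UNIV. \<Sum>t\<in>UNIV. f (w, s, t))" for f :: "_ \<Rightarrow> real"
    by (simp add: sum.cartesian_product case_prod_unfold)
  have sumJ: "(\<Sum>i\<in>?J. f i) = (\<Sum>q\<in>Q. \<Sum>y\<in>UNIV. \<Sum>x\<in>UNIV. \<Sum>v\<in>UNIV. f (q, y, x, v))" for f :: "_ \<Rightarrow> real"
    by (simp add: sum.cartesian_product case_prod_unfold)
  have pmfI: "is_pmf ?I ?P"
    using P0 P1 by (auto simp: is_pmf_def sumI)
  have R1: "(\<Sum>y\<in>UNIV. \<Sum>x\<in>UNIV. \<Sum>v\<in>UNIV. pq q * p q x * r q v * V x v y) = pq q" if q: "q \<in> Q" for q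
  proof -
    have "(\<Sum>y\<in>UNIV. \<Sum>x\<in>UNIV. \<Sum>v\<in>UNIV. pq q * p q x * r q v * V x v y) =
      (\<Sum>x\<in>UNIV. \<Sum>v\<in>UNIV. \<Sum>y\<in>UNIV. pq q * p q x * r q v * V x v y)"
      by (subst sum.swap, intro sum.cong refl, subst sum.swap, rule refl)
    also have "\<dots> = pq q"
      using pD(3)[OF q] rD(3)[OF q] by (simp add: sum_distrib_left[symmetric] V1)
    finally show ?thesis .
  qed
  have pmfJ: "is_pmf ?J ?R"
    using pqD pD(2) rD(2) V0 R1 by (auto simp: is_pmf_def sumJ intro!: mult_nonneg_nonneg finite_cartesian_product)
  have mpos: "0 < ?m i" if "?P i \<noteq> 0" for i
    using that M P0 by (auto simp: less_le split: prod.splits)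
  have npos: "0 < ?n j" if "j \<in> ?J" "?R j \<noteq> 0" for j
    using that N V0 by (auto simp: less_le split: prod.splits)
  have gap': "real k * (\<Sum>i\<in>?I. ?P i * ln (?m i)) + real l * (\<Sum>j\<in>?J. ?R j * ln (?n j)) + c < 0"
    using gap by (simp only: sumI sumJ case_prod_conv)
  obtain e where lam: "0 < e"
    "exp (c * e) * (\<Sum>i\<in>?I. ?P i * ?m i powr e) ^ k * (\<Sum>j\<in>?J. ?R j * ?n j powr e) ^ l < 1"
    (is "?\<rho> < 1")
    using chernoff_exponent[OF pmfI mpos pmfJ npos gap'] by blast
  have "0 \<le> ?\<rho>"
    using is_pmfD(2)[OF pmfI] is_pmfD(2)[OF pmfJ]
    by (intro mult_nonneg_nonneg zero_le_power sum_nonneg) auto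
  moreover have "(\<Sum>qs\<in>words Q n. (\<Prod>j<n. pq (qs ! j)) * 
       tail_prob P V M N p r m n (exp (c * real \<tau>)) qs)
      \<le> ?\<rho> ^ \<tau>" (is "?LHS \<le> _") if mn: "m = k * \<tau>" "n = l * \<tau>" for \<tau> m n
  proof -
    let ?E = "exp (c * real \<tau>) powr e"
    let ?a = "\<lambda>w s t. P s t w * (M s t w / P s t w) powr e"
    let ?b = "\<lambda>q y x v. pq q * p q x * r q v * V x v y * (N q x v y / V x v y) powr e"
    have "?LHS \<le> (\<Sum>qs\<in>words Q n. \<Sum>ws\<in>seqs m. \<Sum>ys\<in>seqs n. \<Sum>ss\<in>seqs m. \<Sum>ts\<in>seqs m. \<Sum>xs\<in>seqs n. \<Sum>vs\<in>seqs n.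
       ?E * ((\<Prod>i<m. ?a (ws ! i) (ss ! i) (ts ! i)) * (\<Prod>j<n. ?b (qs ! j) (ys ! j) (xs ! j) (vs ! j))))"
      unfolding tail_prob_def sum_distrib_left
    proof (intro sum_mono)
      fix qs ws ys ss ts xs vs
      assume qs: "qs \<in> words Q n"
      let ?L = "(\<Prod>i<m. P (ss ! i) (ts ! i) (ws ! i)) * (\<Prod>j<n. V (xs ! j) (vs ! j) (ys ! j))"
      let ?M = "(\<Prod>i<m. M (ss ! i) (ts ! i) (ws ! i)) * (\<Prod>j<n. N (qs ! j) (xs ! j) (vs ! j) (ys ! j))"
      let ?w = "(\<Prod>j<n. pq (qs ! j)) * ((\<Prod>j<n. p (qs ! j) (xs ! j)) * (\<Prod>j<n. r (qs ! j) (vs ! j)))"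
      have "0 \<le> ?w"
        using nth_words[OF qs] pqD(2) pD(2) rD(2) by (auto intro!: prod_nonneg mult_nonneg_nonneg)
      moreover have "?L * of_bool (?L < exp (c * real \<tau>) * ?M) \<le> ?L * (?E * (?M / ?L) powr e)"
        using P0 V0 lam(1) by (intro tilt_bound mult_nonneg_nonneg prod_nonneg ballI) auto
      ultimately have "?w * (?L * of_bool (?L < exp (c * real \<tau>) * ?M)) \<le> ?w * (?L * (?E * (?M / ?L) powr e))"
        by (rule mult_left_mono[rotated])
      also have "(?M / ?L) powr e = (\<Prod>i<m. (M (ss ! i) (ts ! i) (ws ! i) / P (ss ! i) (ts ! i) (ws ! i)) powr e) *
          (\<Prod>j<n. (N (qs ! j) (xs ! j) (vs ! j) (ys ! j) / V (xs ! j) (vs ! j) (ys ! j)) powr e)"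
        by (simp only: prod_powr_distrib[symmetric] powr_mult[symmetric] prod_dividef times_divide_times_eq)
      also have "?w * (?L * (?E * \<dots>)) = ?E * ((\<Prod>i<m. ?a (ws ! i) (ss ! i) (ts ! i)) * (\<Prod>j<n. ?b (qs ! j) (ys ! j) (xs ! j) (vs ! j)))"
        by (simp only: prod.distrib mult_ac)
      finally show "(\<Prod>j<n. pq (qs ! j)) * ((\<Prod>j<n. p (qs ! j) (xs ! j)) * (\<Prod>j<n. r (qs ! j) (vs ! j)) *
           (?L * of_bool (?L < exp (c * real \<tau>) * ?M))) \<le>
          ?E * ((\<Prod>i<m. ?a (ws ! i) (ss ! i) (ts ! i)) * (\<Prod>j<n. ?b (qs ! j) (ys ! j) (xs ! j) (vs ! j)))"
        by (simp only: mult.assoc)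
    qed
    also have "\<dots> = ?E * ((\<Sum>ws\<in>seqs m. \<Sum>ss\<in>seqs m. \<Sum>ts\<in>seqs m. \<Prod>i<m. ?a (ws ! i) (ss ! i) (ts ! i)) *
        (\<Sum>qs\<in>words Q n. \<Sum>ys\<in>seqs n. \<Sum>xs\<in>seqs n. \<Sum>vs\<in>seqs n. \<Prod>j<n. ?b (qs ! j) (ys ! j) (xs ! j) (vs ! j)))"
      by (simp only: sum_distrib_left[symmetric] sum_distrib_right[symmetric])
    also have "(\<Sum>ws\<in>seqs m. \<Sum>ss\<in>seqs m. \<Sum>ts\<in>seqs m. \<Prod>i<m. ?a (ws ! i) (ss ! i) (ts ! i)) =
        (\<Sum>i\<in>?I. ?P i * ?m i powr e) ^ m"
      by (simp only: sumI case_prod_conv) (simp add: sum_seqs_prod[of "\<lambda>i t. ?a (_ ! i) (_ ! i) t"]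
          sum_seqs_prod[of "\<lambda>i s. \<Sum>t\<in>UNIV. ?a (_ ! i) s t"] sum_seqs_prod[of "\<lambda>i w. \<Sum>s\<in>UNIV. \<Sum>t\<in>UNIV. ?a w s t"])
    also have "(\<Sum>qs\<in>words Q n. \<Sum>ys\<in>seqs n. \<Sum>xs\<in>seqs n. \<Sum>vs\<in>seqs n. \<Prod>j<n. ?b (qs ! j) (ys ! j) (xs ! j) (vs ! j)) =
        (\<Sum>j\<in>?J. ?R j * ?n j powr e) ^ n"
      by (simp only: sumJ case_prod_conv) (simp add: sum_seqs_prod[of "\<lambda>i v. ?b (_ ! i) (_ ! i) (_ ! i) v"]
          sum_seqs_prod[of "\<lambda>i x. \<Sum>v\<in>UNIV. ?b (_ ! i) (_ ! i) x v"]
          sum_seqs_prod[of "\<lambda>i y. \<Sum>x\<in>UNIV. \<Sum>v\<in>UNIV. ?b (_ ! i) y x v"]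
          sum_words_prod[of "\<lambda>i q. \<Sum>y\<in>UNIV. \<Sum>x\<in>UNIV. \<Sum>v\<in>UNIV. ?b q y x v"])
    \<comment> \<open>The growing threshold costs a factor \<open>exp (c * e)\<close> per block,
      which \<open>?\<rho>\<close> already contains.\<close>
    also have "?E = exp (c * e) ^ \<tau>"
      by (simp add: powr_def exp_of_nat_mult[symmetric] mult_ac)
    finally show ?thesis
      by (simp add: mn power_mult power_mult_distrib mult.assoc)
  qed
  ultimately show thesis using that lam(2) by blast
qed

section \<open>Entropies as mean log-likelihood ratios\<close>

text \<open>The image of the weight \<open>h\<close> under \<pi>. For a projection \<pi> it is the
  marginal law of the component that a receiver sees.\<close>

definition fiber_sum :: "('a::finite \<Rightarrow> 'b) \<Rightarrow> ('a \<Rightarrow> real) \<Rightarrow> 'b \<Rightarrow> real" where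
  "fiber_sum \<pi> h b = (\<Sum>a\<in>UNIV. if \<pi> a = b then h a else 0)"

lemma sum_fiber_sum:
  fixes \<pi> :: "'a::finite \<Rightarrow> 'b::finite"
  shows "(\<Sum>b\<in>UNIV. fiber_sum \<pi> h b * g b) = (\<Sum>a\<in>UNIV. h a * g (\<pi> a))"
  unfolding fiber_sum_def sum_distrib_right
  by (subst sum.swap) (simp add: if_distrib[of "\<lambda>x. x * _"] cong: if_cong)

lemma fiber_sum_nonneg: "(\<And>a. 0 \<le> h a) \<Longrightarrow> 0 \<le> fiber_sum \<pi> h b"
  unfolding fiber_sum_def by (auto intro: sum_nonneg)

lemma fiber_sum_ge: "(\<And>a. 0 \<le> h a) \<Longrightarrow> h a \<le> fiber_sum \<pi> h (\<pi> a)"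
  unfolding fiber_sum_def
  using member_le_sum[of a UNIV "\<lambda>x. if \<pi> x = \<pi> a then h x else 0"] by simp

text \<open>The factor \<open>ln 2\<close> converts bits to nats, and inverting the quotient absorbs
  the minus sign; this is the form in which the Chernoff exponent produces entropies.\<close>

lemma cond_entropy_ln:
  "cond_entropy \<Omega> P A B * ln 2 =
    (\<Sum>\<omega>\<in>\<Omega>. P \<omega> * ln (pr \<Omega> P (\<lambda>v. B v = B \<omega>) / pr \<Omega> P (\<lambda>v. A v = A \<omega> \<and> B v = B \<omega>)))"
proof -
  have "- log 2 (a / b) * ln 2 = ln (b / a)" for a b :: real
    by (simp add: log_def ln_div)
  then show ?thesis
    by (simp add: cond_entropy_def sum_negf[symmetric] sum_distrib_right mult.assoc flip: mult_minus_right)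
qed

lemma pr_mono:
  assumes "\<And>\<omega>. \<omega> \<in> \<Omega> \<Longrightarrow> 0 \<le> P \<omega>" "\<And>\<omega>. E \<omega> \<Longrightarrow> F \<omega>"
  shows "pr \<Omega> P E \<le> pr \<Omega> P F"
  unfolding pr_def using assms by (intro sum_mono) auto

lemma pr_pos:
  assumes "finite \<Omega>" "\<And>\<omega>. \<omega> \<in> \<Omega> \<Longrightarrow> 0 \<le> P \<omega>" "\<omega> \<in> \<Omega>" "0 < P \<omega>" "E \<omega>"
  shows "0 < pr \<Omega> P E"
  unfolding pr_def using assms by (intro sum_pos2[of _ \<omega>]) auto

text \<open>A joint event is at most as likely as the conditioning event, so every logarithm is
  nonnegative. This serves to show that the rate is positive.\<close>

lemma cond_entropy_nonneg:
  assumes "is_pmf \<Omega> P"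
  shows "0 \<le> cond_entropy \<Omega> P A B"
proof -
  note PD = is_pmfD[OF assms]
  have "0 \<le> P \<omega> * ln (pr \<Omega> P (\<lambda>v. B v = B \<omega>) / pr \<Omega> P (\<lambda>v. A v = A \<omega> \<and> B v = B \<omega>))" if "\<omega> \<in> \<Omega>" for \<omega>
  proof (cases "P \<omega> = 0")
    case False
    then have "0 < pr \<Omega> P (\<lambda>v. A v = A \<omega> \<and> B v = B \<omega>)"
      using PD that by (intro pr_pos[where \<omega> = \<omega>]) (auto simp: less_le)
    moreover have "pr \<Omega> P (\<lambda>v. A v = A \<omega> \<and> B v = B \<omega>) \<le> pr \<Omega> P (\<lambda>v. B v = B \<omega>)"
      using PD by (intro pr_mono) auto
    ultimately show ?thesis using PD(2)[OF that] by simp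
  qed simp
  then have "0 \<le> cond_entropy \<Omega> P A B * ln 2"
    unfolding cond_entropy_ln by (rule sum_nonneg)
  then show ?thesis by (simp add: zero_le_mult_iff)
qed

lemma if_conj_zero: "(if a \<and> b then x else 0) = (if a then if b then x else 0 else (0::real))"
  by simp

lemma sum_if_const: "(\<Sum>i\<in>I. if c then f i else (0::real)) = (if c then \<Sum>i\<in>I. f i else 0)"
  by simp

lemma pr_triple:
  fixes P :: "'s::finite \<times> 't::finite \<times> 'u::finite \<Rightarrow> real"
  shows "pr UNIV P E = (\<Sum>s\<in>UNIV. \<Sum>t\<in>UNIV. \<Sum>u\<in>UNIV. if E (s, t, u) then P (s, t, u) else 0)"
  unfolding pr_def by (simp add: sum.cartesian_product case_prod_unfold cong: if_cong)

text \<open>The quotients, marginal over joint weight, are the source factors of the three tests, so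
  the source part of the exponent in \<open>tail_bound\<close> is a conditional entropy.\<close>

lemma source_entropies:
  fixes P :: "'s::finite \<times> 't::finite \<times> 'u::finite \<Rightarrow> real" and \<pi> :: "'u \<Rightarrow> 'w::finite"
  defines "p \<equiv> \<lambda>s t. fiber_sum \<pi> (\<lambda>u. P (s, t, u))"
  shows "cond_entropy UNIV P fst (\<lambda>\<omega>. (fst (snd \<omega>), \<pi> (snd (snd \<omega>)))) * ln 2 =
      (\<Sum>w\<in>UNIV. \<Sum>s\<in>UNIV. \<Sum>t\<in>UNIV. p s t w * ln ((\<Sum>s\<in>UNIV. p s t w) / p s t w))" (is ?S)
    and "cond_entropy UNIV P (\<lambda>\<omega>. fst (snd \<omega>)) (\<lambda>\<omega>. (fst \<omega>, \<pi> (snd (snd \<omega>)))) * ln 2 =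
      (\<Sum>w\<in>UNIV. \<Sum>s\<in>UNIV. \<Sum>t\<in>UNIV. p s t w * ln ((\<Sum>t\<in>UNIV. p s t w) / p s t w))" (is ?T)
    and "cond_entropy UNIV P (\<lambda>\<omega>. (fst \<omega>, fst (snd \<omega>))) (\<lambda>\<omega>. \<pi> (snd (snd \<omega>))) * ln 2 =
      (\<Sum>w\<in>UNIV. \<Sum>s\<in>UNIV. \<Sum>t\<in>UNIV. p s t w * ln ((\<Sum>s\<in>UNIV. \<Sum>t\<in>UNIV. p s t w) / p s t w))" (is ?B)
proof -
  have regroup: "(\<Sum>\<omega>\<in>UNIV. P \<omega> * g (fst \<omega>) (fst (snd \<omega>)) (\<pi> (snd (snd \<omega>)))) =
      (\<Sum>w\<in>UNIV. \<Sum>s\<in>UNIV. \<Sum>t\<in>UNIV. p s t w * g s t w)" for g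
  proof -
    have "(\<Sum>\<omega>\<in>UNIV. P \<omega> * g (fst \<omega>) (fst (snd \<omega>)) (\<pi> (snd (snd \<omega>)))) =
      (\<Sum>s\<in>UNIV. \<Sum>t\<in>UNIV. \<Sum>u\<in>UNIV. P (s, t, u) * g s t (\<pi> u))"
      by (simp add: sum.cartesian_product case_prod_unfold)
    also have "\<dots> = (\<Sum>s\<in>UNIV. \<Sum>t\<in>UNIV. \<Sum>w\<in>UNIV. p s t w * g s t w)"
      by (simp only: p_def sum_fiber_sum)
    also have "\<dots> = (\<Sum>s\<in>UNIV. \<Sum>w\<in>UNIV. \<Sum>t\<in>UNIV. p s t w * g s t w)"
      by (intro sum.cong refl sum.swap)
    also have "\<dots> = (\<Sum>w\<in>UNIV. \<Sum>s\<in>UNIV. \<Sum>t\<in>UNIV. p s t w * g s t w)"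
      by (rule sum.swap)
    finally show ?thesis .
  qed
  have simps: "pr UNIV P (\<lambda>v. fst v = s \<and> fst (snd v) = t \<and> \<pi> (snd (snd v)) = w) = p s t w"
    "pr UNIV P (\<lambda>v. fst (snd v) = t \<and> fst v = s \<and> \<pi> (snd (snd v)) = w) = p s t w"
    "pr UNIV P (\<lambda>v. (fst v = s \<and> fst (snd v) = t) \<and> \<pi> (snd (snd v)) = w) = p s t w"
    "pr UNIV P (\<lambda>v. fst (snd v) = t \<and> \<pi> (snd (snd v)) = w) = (\<Sum>s\<in>UNIV. p s t w)"
    "pr UNIV P (\<lambda>v. fst v = s \<and> \<pi> (snd (snd v)) = w) = (\<Sum>t\<in>UNIV. p s t w)"
    "pr UNIV P (\<lambda>v. \<pi> (snd (snd v)) = w) = (\<Sum>s\<in>UNIV. \<Sum>t\<in>UNIV. p s t w)" for s t w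
    unfolding pr_triple p_def fiber_sum_def by (simp_all add: if_conj_zero sum_if_const)
  show ?S unfolding cond_entropy_ln prod.inject simps
    by (rule regroup[of "\<lambda>s t w. ln ((\<Sum>s\<in>UNIV. p s t w) / p s t w)"])
  show ?T unfolding cond_entropy_ln prod.inject simps
    by (rule regroup[of "\<lambda>s t w. ln ((\<Sum>t\<in>UNIV. p s t w) / p s t w)"])
  show ?B unfolding cond_entropy_ln prod.inject simps
    by (rule regroup[of "\<lambda>s t w. ln ((\<Sum>s\<in>UNIV. \<Sum>t\<in>UNIV. p s t w) / p s t w)"])
qed

text \<open>Read \<alpha> as the law of \<open>A\<close> given \<open>B\<close>, \<beta> as that of
  \<open>B\<close>, and \<open>N\<close> and \<open>V\<close> as the laws of \<open>Y\<close> given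
  \<open>B\<close> and given both. In the difference of entropies \<alpha> and \<beta> cancel, and
  the channel ratio \<open>N / V\<close> of the test remains.\<close>

lemma cond_mutual_info_ratio:
  assumes "\<And>\<omega>. \<omega> \<in> \<Omega> \<Longrightarrow> P \<omega> \<noteq> 0 \<Longrightarrow> 0 < \<alpha> \<omega> \<and> 0 < \<beta> \<omega> \<and> 0 < V \<omega> \<and> 0 < N \<omega>"
    and "\<And>\<omega>. \<omega> \<in> \<Omega> \<Longrightarrow> pr \<Omega> P (\<lambda>v. B v = B \<omega>) = \<beta> \<omega>"
    and "\<And>\<omega>. \<omega> \<in> \<Omega> \<Longrightarrow> pr \<Omega> P (\<lambda>v. A v = A \<omega> \<and> B v = B \<omega>) = \<alpha> \<omega> * \<beta> \<omega>"
    and "\<And>\<omega>. \<omega> \<in> \<Omega> \<Longrightarrow> pr \<Omega> P (\<lambda>v. Y v = Y \<omega> \<and> B v = B \<omega>) = \<beta> \<omega> * N \<omega>"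
    and "\<And>\<omega>. \<omega> \<in> \<Omega> \<Longrightarrow> pr \<Omega> P (\<lambda>v. A v = A \<omega> \<and> Y v = Y \<omega> \<and> B v = B \<omega>) = \<alpha> \<omega> * \<beta> \<omega> * V \<omega>"
  shows "cond_mutual_info \<Omega> P A Y B * ln 2 = - (\<Sum>\<omega>\<in>\<Omega>. P \<omega> * ln (N \<omega> / V \<omega>))"
proof -
  have "cond_mutual_info \<Omega> P A Y B * ln 2 =
     (\<Sum>\<omega>\<in>\<Omega>. P \<omega> * ln (\<beta> \<omega> / (\<alpha> \<omega> * \<beta> \<omega>)) - P \<omega> * ln (\<beta> \<omega> * N \<omega> / (\<alpha> \<omega> * \<beta> \<omega> * V \<omega>)))"
    unfolding cond_mutual_info_def left_diff_distrib cond_entropy_ln sum_subtractf prod.inject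
    using assms(2-5) by simp
  also have "\<dots> = (\<Sum>\<omega>\<in>\<Omega>. - (P \<omega> * ln (N \<omega> / V \<omega>)))"
  proof (rule sum.cong[OF refl])
    fix \<omega> assume w: "\<omega> \<in> \<Omega>"
    show "P \<omega> * ln (\<beta> \<omega> / (\<alpha> \<omega> * \<beta> \<omega>)) - P \<omega> * ln (\<beta> \<omega> * N \<omega> / (\<alpha> \<omega> * \<beta> \<omega> * V \<omega>)) =
        - (P \<omega> * ln (N \<omega> / V \<omega>))"
    proof (cases "P \<omega> = 0")
      case False
      with assms(1)[OF w] have "0 < \<alpha> \<omega>" "0 < \<beta> \<omega>" "0 < V \<omega>" "0 < N \<omega>" by auto
      then show ?thesis by (simp add: ln_div ln_mult algebra_simps)
    qed simp
  qed
  finally show ?thesis by (simp add: sum_negf)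
qed

text \<open>Follows from \<open>ln t \<le> t - 1\<close>, averaged with the weights
  \<open>P\<close>.\<close>

lemma gibbs:
  fixes P r :: "'i \<Rightarrow> real"
  assumes "finite I" "\<And>i. i \<in> I \<Longrightarrow> 0 \<le> P i" "\<And>i. i \<in> I \<Longrightarrow> P i \<noteq> 0 \<Longrightarrow> 0 < r i"
    and "(\<Sum>i\<in>I. P i * r i) \<le> sum P I"
  shows "(\<Sum>i\<in>I. P i * ln (r i)) \<le> 0"
proof -
  have "(\<Sum>i\<in>I. P i * ln (r i)) \<le> (\<Sum>i\<in>I. P i * (r i - 1))"
  proof (rule sum_mono)
    fix i assume i: "i \<in> I"
    show "P i * ln (r i) \<le> P i * (r i - 1)"
      using assms(2,3)[OF i] ln_le_minus_one[of "r i"] by (cases "P i = 0") (auto intro!: mult_left_mono)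
  qed
  also have "\<dots> \<le> 0" using assms(4) by (simp add: right_diff_distrib sum_subtractf)
  finally show ?thesis .
qed

section \<open>Channel informations of one receiver under time sharing\<close>

context
  fixes W :: "'x::finite \<Rightarrow> 'v::finite \<Rightarrow> 'z::finite \<Rightarrow> real" and \<pi> :: "'z \<Rightarrow> 'y::finite"
    and Q :: "'q set" and pq :: "'q \<Rightarrow> real" and p :: "'q \<Rightarrow> 'x \<Rightarrow> real" and r :: "'q \<Rightarrow> 'v \<Rightarrow> real"
  assumes chan: "\<And>x v. is_pmf UNIV (W x v)" and pq: "is_pmf Q pq"
    and p: "\<And>q. q \<in> Q \<Longrightarrow> is_pmf UNIV (p q)" and r: "\<And>q. q \<in> Q \<Longrightarrow> is_pmf UNIV (r q)"
begin

private definition "J = (\<lambda>(q, x, v, y). pq q * p q x * r q v * W x v y)"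
private definition "V = (\<lambda>x v. fiber_sum \<pi> (W x v))"

private lemma sumJ: "(\<Sum>\<omega>\<in>Q \<times> UNIV. f \<omega>) = 
    (\<Sum>q\<in>Q. \<Sum>x\<in>UNIV. \<Sum>v\<in>UNIV. \<Sum>y\<in>UNIV. f (q, x, v, y))" for f :: "'q \<times> 'x \<times> 'v \<times> 'z \<Rightarrow> real"
  by (simp add: sum.cartesian_product case_prod_unfold)

private lemma sumW: "(\<Sum>y\<in>UNIV. W x v y) = 1"
  using is_pmfD[OF chan] by simp

lemma sum_channel_marginal: "(\<Sum>y\<in>UNIV. fiber_sum \<pi> (W x v) y) = 1"
  using sum_fiber_sum[of \<pi> "W x v" "\<lambda>_. 1"] sumW by simp

private lemma J_pos:
  assumes "q \<in> Q" "J (q, x, v, y) \<noteq> 0"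
  shows "0 < pq q" "0 < p q x" "0 < r q v" "0 < V x v (\<pi> y)"
    "0 < (\<Sum>x\<in>UNIV. p q x * V x v (\<pi> y))" "0 < (\<Sum>v\<in>UNIV. r q v * V x v (\<pi> y))"
    "0 < (\<Sum>x\<in>UNIV. \<Sum>v\<in>UNIV. p q x * r q v * V x v (\<pi> y))"
proof -
  have nn: "0 \<le> p q x" "0 \<le> r q v" "0 \<le> V x v y" for x v y
    using is_pmfD(2)[OF p] is_pmfD(2)[OF r] is_pmfD(2)[OF chan] assms(1)
    by (auto simp: V_def intro: fiber_sum_nonneg)
  show a: "0 < pq q" "0 < p q x" "0 < r q v"
    using assms is_pmfD(2)[OF pq] nn by (auto simp: J_def less_le)
  have "0 < W x v y" using assms is_pmfD(2)[OF chan] by (auto simp: J_def less_le)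
  then show b: "0 < V x v (\<pi> y)"
    using fiber_sum_ge[of "W x v" y \<pi>] is_pmfD(2)[OF chan] by (auto simp: V_def)
  show "0 < (\<Sum>x\<in>UNIV. p q x * V x v (\<pi> y))" "0 < (\<Sum>v\<in>UNIV. r q v * V x v (\<pi> y))"
    using a b nn by (auto intro!: sum_pos2[of _ x] sum_pos2[of _ v])
  show "0 < (\<Sum>x\<in>UNIV. \<Sum>v\<in>UNIV. p q x * r q v * V x v (\<pi> y))"
    using a b nn by (auto intro!: sum_pos2[of _ x] sum_pos2[of _ v] sum_nonneg)
qed

text \<open>The unseen part of the output is summed out, which turns \<open>W\<close> into the
  receiver's own channel \<open>V\<close>. The output then moves outside the inputs, to the order of
  summation in the exponent of \<open>tail_bound\<close>.\<close>

private lemma J_regroup: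
  "(\<Sum>\<omega>\<in>Q \<times> UNIV. J \<omega> * g (fst \<omega>) (fst (snd \<omega>)) (fst (snd (snd \<omega>))) (\<pi> (snd (snd (snd \<omega>))))) =
    (\<Sum>q\<in>Q. \<Sum>y\<in>UNIV. \<Sum>x\<in>UNIV. \<Sum>v\<in>UNIV. pq q * p q x * r q v * V x v y * g q x v y)"
proof -
  have "(\<Sum>\<omega>\<in>Q \<times> UNIV. J \<omega> * g (fst \<omega>) (fst (snd \<omega>)) (fst (snd (snd \<omega>))) (\<pi> (snd (snd (snd \<omega>))))) =
      (\<Sum>q\<in>Q. \<Sum>x\<in>UNIV. \<Sum>v\<in>UNIV. pq q * p q x * r q v * (\<Sum>y\<in>UNIV. W x v y * g q x v (\<pi> y)))"
    by (simp add: sumJ J_def sum_distrib_left mult.assoc)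
  also have "\<dots> = (\<Sum>q\<in>Q. \<Sum>x\<in>UNIV. \<Sum>v\<in>UNIV. \<Sum>y\<in>UNIV. pq q * p q x * r q v * V x v y * g q x v y)"
    by (simp only: sum_fiber_sum[symmetric] V_def sum_distrib_left mult.assoc)
  also have "\<dots> = (\<Sum>q\<in>Q. \<Sum>x\<in>UNIV. \<Sum>y\<in>UNIV. \<Sum>v\<in>UNIV. pq q * p q x * r q v * V x v y * g q x v y)"
    by (intro sum.cong refl sum.swap)
  also have "\<dots> = (\<Sum>q\<in>Q. \<Sum>y\<in>UNIV. \<Sum>x\<in>UNIV. \<Sum>v\<in>UNIV. pq q * p q x * r q v * V x v y * g q x v y)"
    by (intro sum.cong refl sum.swap)
  finally show ?thesis .
qed

text \<open>These are the events to which the three informations unfold, with the products arranged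
  for \<alpha>, \<beta>, \<open>V\<close> and \<open>N\<close> in
  \<open>cond_mutual_info_ratio\<close>.\<close>

private lemma pr_J:
  assumes q: "q \<in> Q"
  shows "pr (Q \<times> UNIV) J (\<lambda>u. fst u = q) = pq q"
    "pr (Q \<times> UNIV) J (\<lambda>u. fst (snd (snd u)) = v \<and> fst u = q) = r q v * pq q"
    "pr (Q \<times> UNIV) J (\<lambda>u. fst (snd u) = x \<and> fst u = q) = p q x * pq q"
    "pr (Q \<times> UNIV) J (\<lambda>u. fst (snd u) = x \<and> fst (snd (snd u)) = v \<and> fst u = q) = p q x * (r q v * pq q)"
    "pr (Q \<times> UNIV) J (\<lambda>u. fst (snd (snd u)) = v \<and> fst (snd u) = x \<and> fst u = q) = r q v * (p q x * pq q)"
    "pr (Q \<times> UNIV) J (\<lambda>u. fst (snd u) = x \<and> \<pi> (snd (snd (snd u))) = y \<and> fst (snd (snd u)) = v \<and> fst u = q) =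
      p q x * (r q v * pq q) * V x v y"
    "pr (Q \<times> UNIV) J (\<lambda>u. fst (snd (snd u)) = v \<and> \<pi> (snd (snd (snd u))) = y \<and> fst (snd u) = x \<and> fst u = q) =
      r q v * (p q x * pq q) * V x v y"
    "pr (Q \<times> UNIV) J (\<lambda>u. fst (snd u) = x \<and> fst (snd (snd u)) = v \<and> \<pi> (snd (snd (snd u))) = y \<and> fst u = q) =
      p q x * r q v * pq q * V x v y"
    "pr (Q \<times> UNIV) J (\<lambda>u. \<pi> (snd (snd (snd u))) = y \<and> fst (snd (snd u)) = v \<and> fst u = q) =
      r q v * pq q * (\<Sum>x\<in>UNIV. p q x * V x v y)"
    "pr (Q \<times> UNIV) J (\<lambda>u. \<pi> (snd (snd (snd u))) = y \<and> fst (snd u) = x \<and> fst u = q) =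
      p q x * pq q * (\<Sum>v\<in>UNIV. r q v * V x v y)"
    "pr (Q \<times> UNIV) J (\<lambda>u. \<pi> (snd (snd (snd u))) = y \<and> fst u = q) =
      pq q * (\<Sum>x\<in>UNIV. \<Sum>v\<in>UNIV. p q x * r q v * V x v y)"
proof -
  have fib: "(\<Sum>z\<in>UNIV. if \<pi> z = y then c * W x v z else 0) = c * V x v y" for c x v y
    unfolding V_def fiber_sum_def sum_distrib_left by (intro sum.cong) auto
  \<comment> \<open>Moves the test on the output innermost, where \<open>fib\<close> evaluates the
    sum over \<open>z\<close>.\<close>
  have if_swap: "(if \<pi> z = y then if b then t else 0 else 0) = (if b then if \<pi> z = y then t else 0 else (0::real))"
    for z y b t
    by simp
  have J: "J (q, x, v, z) = pq q * p q x * r q v * W x v z" for q x v z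
    by (simp add: J_def)
  note D = is_pmfD(3)[OF p[OF q]] is_pmfD(3)[OF r[OF q]] is_pmfD(1)[OF pq]
  note S = pr_def sumJ J if_conj_zero sum_if_const sum_distrib_left[symmetric] sumW fib if_swap
  show "pr (Q \<times> UNIV) J (\<lambda>u. fst u = q) = pq q"
    "pr (Q \<times> UNIV) J (\<lambda>u. fst (snd (snd u)) = v \<and> fst u = q) = r q v * pq q"
    "pr (Q \<times> UNIV) J (\<lambda>u. fst (snd u) = x \<and> fst u = q) = p q x * pq q"
    "pr (Q \<times> UNIV) J (\<lambda>u. fst (snd u) = x \<and> fst (snd (snd u)) = v \<and> fst u = q) = p q x * (r q v * pq q)"
    "pr (Q \<times> UNIV) J (\<lambda>u. fst (snd (snd u)) = v \<and> fst (snd u) = x \<and> fst u = q) = r q v * (p q x * pq q)"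
    using q D by (simp_all add: S sum_distrib_right[symmetric] cong: if_cong)
  show "pr (Q \<times> UNIV) J (\<lambda>u. fst (snd u) = x \<and> \<pi> (snd (snd (snd u))) = y \<and> fst (snd (snd u)) = v \<and> fst u = q) =
      p q x * (r q v * pq q) * V x v y"
    "pr (Q \<times> UNIV) J (\<lambda>u. fst (snd (snd u)) = v \<and> \<pi> (snd (snd (snd u))) = y \<and> fst (snd u) = x \<and> fst u = q) =
      r q v * (p q x * pq q) * V x v y"
    "pr (Q \<times> UNIV) J (\<lambda>u. fst (snd u) = x \<and> fst (snd (snd u)) = v \<and> \<pi> (snd (snd (snd u))) = y \<and> fst u = q) =
      p q x * r q v * pq q * V x v y"
    "pr (Q \<times> UNIV) J (\<lambda>u. \<pi> (snd (snd (snd u))) = y \<and> fst (snd (snd u)) = v \<and> fst u = q) =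
      r q v * pq q * (\<Sum>x\<in>UNIV. p q x * V x v y)"
    "pr (Q \<times> UNIV) J (\<lambda>u. \<pi> (snd (snd (snd u))) = y \<and> fst (snd u) = x \<and> fst u = q) =
      p q x * pq q * (\<Sum>v\<in>UNIV. r q v * V x v y)"
    "pr (Q \<times> UNIV) J (\<lambda>u. \<pi> (snd (snd (snd u))) = y \<and> fst u = q) =
      pq q * (\<Sum>x\<in>UNIV. \<Sum>v\<in>UNIV. p q x * r q v * V x v y)"
    using q D by (simp add: S cong: if_cong; simp add: sum_distrib_left mult_ac)+
qed

private lemma channel_infos_aux:
  shows "cond_mutual_info (Q \<times> UNIV) J (\<lambda>\<omega>. fst (snd \<omega>)) (\<lambda>\<omega>. \<pi> (snd (snd (snd \<omega>))))
      (\<lambda>\<omega>. (fst (snd (snd \<omega>)), fst \<omega>)) * ln 2 =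
    - (\<Sum>q\<in>Q. \<Sum>y\<in>UNIV. \<Sum>x\<in>UNIV. \<Sum>v\<in>UNIV. pq q * p q x * r q v * V x v y *
        ln ((\<Sum>x\<in>UNIV. p q x * V x v y) / V x v y))" (is ?X)
    and "cond_mutual_info (Q \<times> UNIV) J (\<lambda>\<omega>. fst (snd (snd \<omega>))) (\<lambda>\<omega>. \<pi> (snd (snd (snd \<omega>))))
      (\<lambda>\<omega>. (fst (snd \<omega>), fst \<omega>)) * ln 2 =
    - (\<Sum>q\<in>Q. \<Sum>y\<in>UNIV. \<Sum>x\<in>UNIV. \<Sum>v\<in>UNIV. pq q * p q x * r q v * V x v y *
        ln ((\<Sum>v\<in>UNIV. r q v * V x v y) / V x v y))" (is ?V)
    and "cond_mutual_info (Q \<times> UNIV) J (\<lambda>\<omega>. (fst (snd \<omega>), fst (snd (snd \<omega>)))) (\<lambda>\<omega>. \<pi> (snd (snd (snd \<omega>))))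
      fst * ln 2 =
    - (\<Sum>q\<in>Q. \<Sum>y\<in>UNIV. \<Sum>x\<in>UNIV. \<Sum>v\<in>UNIV. pq q * p q x * r q v * V x v y *
        ln ((\<Sum>x\<in>UNIV. \<Sum>v\<in>UNIV. p q x * r q v * V x v y) / V x v y))" (is ?B)
proof -
  let ?q = "fst :: 'q \<times> 'x \<times> 'v \<times> 'z \<Rightarrow> 'q"
  let ?x = "\<lambda>\<omega>::'q \<times> 'x \<times> 'v \<times> 'z. fst (snd \<omega>)"
  let ?v = "\<lambda>\<omega>::'q \<times> 'x \<times> 'v \<times> 'z. fst (snd (snd \<omega>))"
  let ?y = "\<lambda>\<omega>::'q \<times> 'x \<times> 'v \<times> 'z. \<pi> (snd (snd (snd \<omega>)))"
  have "cond_mutual_info (Q \<times> UNIV) J ?x ?y (\<lambda>\<omega>. (?v \<omega>, ?q \<omega>)) * ln 2 =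
      - (\<Sum>\<omega>\<in>Q \<times> UNIV. J \<omega> * ln ((\<Sum>x\<in>UNIV. p (?q \<omega>) x * V x (?v \<omega>) (?y \<omega>)) / V (?x \<omega>) (?v \<omega>) (?y \<omega>)))"
    by (rule cond_mutual_info_ratio[where \<alpha> = "\<lambda>\<omega>. p (?q \<omega>) (?x \<omega>)" and \<beta> = "\<lambda>\<omega>. r (?q \<omega>) (?v \<omega>) * pq (?q \<omega>)"])
      (clarsimp simp: pr_J J_pos)+
  also note J_regroup[of "\<lambda>q x v y. ln ((\<Sum>x\<in>UNIV. p q x * V x v y) / V x v y)"]
  finally show ?X .
  have "cond_mutual_info (Q \<times> UNIV) J ?v ?y (\<lambda>\<omega>. (?x \<omega>, ?q \<omega>)) * ln 2 =
      - (\<Sum>\<omega>\<in>Q \<times> UNIV. J \<omega> * ln ((\<Sum>v\<in>UNIV. r (?q \<omega>) v * V (?x \<omega>) v (?y \<omega>)) / V (?x \<omega>) (?v \<omega>) (?y \<omega>)))"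
    by (rule cond_mutual_info_ratio[where \<alpha> = "\<lambda>\<omega>. r (?q \<omega>) (?v \<omega>)" and \<beta> = "\<lambda>\<omega>. p (?q \<omega>) (?x \<omega>) * pq (?q \<omega>)"])
      (clarsimp simp: pr_J J_pos)+
  also note J_regroup[of "\<lambda>q x v y. ln ((\<Sum>v\<in>UNIV. r q v * V x v y) / V x v y)"]
  finally show ?V .
  have "cond_mutual_info (Q \<times> UNIV) J (\<lambda>\<omega>. (?x \<omega>, ?v \<omega>)) ?y ?q * ln 2 =
      - (\<Sum>\<omega>\<in>Q \<times> UNIV. J \<omega> * ln ((\<Sum>x\<in>UNIV. \<Sum>v\<in>UNIV. p (?q \<omega>) x * r (?q \<omega>) v * V x v (?y \<omega>)) /
          V (?x \<omega>) (?v \<omega>) (?y \<omega>)))"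
    by (rule cond_mutual_info_ratio[where \<alpha> = "\<lambda>\<omega>. p (?q \<omega>) (?x \<omega>) * r (?q \<omega>) (?v \<omega>)" and \<beta> = "\<lambda>\<omega>. pq (?q \<omega>)"])
      (clarsimp simp: pr_J J_pos)+
  also note J_regroup[of "\<lambda>q x v y. ln ((\<Sum>x\<in>UNIV. \<Sum>v\<in>UNIV. p q x * r q v * V x v y) / V x v y)"]
  finally show ?B .
qed

lemmas channel_infos = channel_infos_aux[unfolded J_def V_def]

text \<open>Replacing \<open>V\<close> by its average \<open>N\<close> over the first input gives a
  probability law again, so \<open>N / V\<close> has mean at most 1 and \<open>gibbs\<close>
  applies. This one information suffices to fix the sign of \<open>b\<close>.\<close>

lemma channel_info_nonneg:
  "0 \<le> cond_mutual_info (Q \<times> UNIV) (\<lambda>(q, x, v, y). pq q * p q x * r q v * W x v y)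
     (\<lambda>\<omega>. fst (snd \<omega>)) (\<lambda>\<omega>. \<pi> (snd (snd (snd \<omega>)))) (\<lambda>\<omega>. (fst (snd (snd \<omega>)), fst \<omega>))"
proof -
  let ?N = "\<lambda>q v y. \<Sum>x\<in>UNIV. p q x * V x v y"
  let ?g = "\<lambda>q x v y. ?N q v y / V x v y"
  have nn: "0 \<le> V x v y" for x v y
    using is_pmfD(2)[OF chan] by (auto simp: V_def intro: fiber_sum_nonneg)
  have V1: "(\<Sum>y\<in>UNIV. V x v y) = 1" for x v
    by (simp add: V_def sum_channel_marginal)
  have "(\<Sum>\<omega>\<in>Q \<times> UNIV. J \<omega> * ?g (fst \<omega>) (fst (snd \<omega>)) (fst (snd (snd \<omega>))) (\<pi> (snd (snd (snd \<omega>))))) =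
      (\<Sum>q\<in>Q. \<Sum>y\<in>UNIV. \<Sum>x\<in>UNIV. \<Sum>v\<in>UNIV. pq q * p q x * r q v * V x v y * ?g q x v y)"
    by (rule J_regroup)
  \<comment> \<open>Only an inequality: terms with \<open>V x v y = 0\<close> vanish on the left but
    may carry weight on the right.\<close>
  also have "\<dots> \<le> (\<Sum>q\<in>Q. \<Sum>y\<in>UNIV. \<Sum>x\<in>UNIV. \<Sum>v\<in>UNIV. p q x * (pq q * r q v * ?N q v y))"
  proof (intro sum_mono)
    fix q y x v assume q: "q \<in> Q"
    have "0 \<le> p q x * (pq q * r q v * ?N q v y)"
      using is_pmfD(2)[OF p[OF q]] is_pmfD(2)[OF r[OF q]] is_pmfD(2)[OF pq q] nn
      by (intro mult_nonneg_nonneg sum_nonneg) auto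
    then show "pq q * p q x * r q v * V x v y * ?g q x v y \<le> p q x * (pq q * r q v * ?N q v y)"
      by (cases "V x v y = 0") (simp_all add: mult_ac)
  qed
  also have "\<dots> = (\<Sum>q\<in>Q. \<Sum>y\<in>UNIV. \<Sum>v\<in>UNIV. pq q * r q v * ?N q v y)"
    using is_pmfD(3)[OF p] by (simp add: sum_distrib_left[symmetric] sum_distrib_right[symmetric])
  also have "\<dots> = (\<Sum>q\<in>Q. \<Sum>v\<in>UNIV. pq q * r q v * (\<Sum>x\<in>UNIV. p q x * (\<Sum>y\<in>UNIV. V x v y)))"
    unfolding sum_distrib_left
    by (intro sum.cong refl, subst sum.swap, intro sum.cong refl, subst sum.swap, rule refl)
  also have "\<dots> = 1"
    using is_pmfD(3)[OF p] is_pmfD(3)[OF r] is_pmfD(3)[OF pq] by (simp add: V1 sum_distrib_left[symmetric])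
  also have "1 = sum J (Q \<times> UNIV)"
    using is_pmfD(3)[OF p] is_pmfD(3)[OF r] is_pmfD(3)[OF pq]
    by (simp add: sumJ J_def sumW sum_distrib_left[symmetric])
  finally have le: "(\<Sum>\<omega>\<in>Q \<times> UNIV. J \<omega> * ?g (fst \<omega>) (fst (snd \<omega>)) (fst (snd (snd \<omega>))) (\<pi> (snd (snd (snd \<omega>))))) \<le>
      sum J (Q \<times> UNIV)" .
  have "(\<Sum>\<omega>\<in>Q \<times> UNIV. J \<omega> * ln (?g (fst \<omega>) (fst (snd \<omega>)) (fst (snd (snd \<omega>))) (\<pi> (snd (snd (snd \<omega>)))))) \<le> 0"
  proof (rule gibbs[OF _ _ _ le])
    show "finite (Q \<times> (UNIV :: ('x \<times> 'v \<times> 'z) set))" using is_pmfD(1)[OF pq] by simp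
    fix \<omega> assume w: "\<omega> \<in> Q \<times> (UNIV :: ('x \<times> 'v \<times> 'z) set)"
    then show "0 \<le> J \<omega>"
      using is_pmfD(2)[OF p] is_pmfD(2)[OF r] is_pmfD(2)[OF pq] is_pmfD(2)[OF chan] by (auto simp: J_def)
    assume "J \<omega> \<noteq> 0"
    then show "0 < ?g (fst \<omega>) (fst (snd \<omega>)) (fst (snd (snd \<omega>))) (\<pi> (snd (snd (snd \<omega>))))"
      using w by (cases \<omega>) (auto intro!: divide_pos_pos J_pos)
  qed
  then have "0 \<le> cond_mutual_info (Q \<times> UNIV) J
     (\<lambda>\<omega>. fst (snd \<omega>)) (\<lambda>\<omega>. \<pi> (snd (snd (snd \<omega>)))) (\<lambda>\<omega>. (fst (snd (snd \<omega>)), fst \<omega>)) * ln 2"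
    unfolding channel_infos_aux by (subst (asm) J_regroup) simp
  then show ?thesis by (simp add: J_def zero_le_mult_iff)
qed

end

section \<open>Transmission of source words\<close>

lemma code_avg_less_witness:
  assumes "finite A" "is_pmf X p" "code_avg A X p \<phi> < e"
  obtains f where "f \<in> A \<rightarrow>\<^sub>E X" "\<phi> f < e"
proof (rule ccontr)
  assume "\<not> thesis"
  then have "code_avg A X p (\<lambda>_. e) \<le> code_avg A X p \<phi>"
    using that by (intro code_avg_mono[OF assms(2)]) force
  then show False using assms by (simp add: code_avg_const)
qed

lemma pmf_avg_less_witness:
  assumes "is_pmf A w" "(\<Sum>a\<in>A. w a * \<phi> a) < e"
  obtains a where "a \<in> A" "\<phi> a < e"
proof (rule ccontr)
  assume "\<not> thesis"
  then have "(\<Sum>a\<in>A. w a * e) \<le> (\<Sum>a\<in>A. w a * \<phi> a)"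
    using that is_pmfD[OF assms(1)] by (intro sum_mono mult_left_mono) force+
  then show False using assms is_pmfD[OF assms(1)] by (simp add: sum_distrib_right[symmetric])
qed

text \<open>The maps \<open>\<pi>w\<close> and \<open>\<pi>y\<close> select the components of side information and channel output
  that the receiver observes; they are \<open>fst\<close> or \<open>snd\<close> for the two receivers.\<close>
definition receiver_error ::
  "('s \<times> 't \<times> 'u \<Rightarrow> real) \<Rightarrow> ('x \<Rightarrow> 'v \<Rightarrow> 'z \<Rightarrow> real) \<Rightarrow> ('u \<Rightarrow> 'w) \<Rightarrow> ('z \<Rightarrow> 'y) \<Rightarrow> nat \<Rightarrow> nat \<Rightarrow>
   ('s list \<Rightarrow> 'x list) \<Rightarrow> ('t list \<Rightarrow> 'v list) \<Rightarrow> ('y list \<Rightarrow> 'w list \<Rightarrow> 's list \<times> 't list) \<Rightarrow> real" where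
  "receiver_error P W \<pi>w \<pi>y m n f g d =
    (\<Sum>u\<in>seqs m. prod_list (map P u) *
      (\<Sum>z\<in>seqs n. (\<Prod>j<n. W (f (map fst u) ! j) (g (map (fst \<circ> snd) u) ! j) (z ! j)) *
        of_bool (d (map \<pi>y z) (map (\<pi>w \<circ> snd \<circ> snd) u) \<noteq> (map fst u, map (fst \<circ> snd) u))))"

lemma prod_list_map_nth: "prod_list (map P u) = (\<Prod>i<length u. P (u ! i))"
  for P :: "'a \<Rightarrow> real"
  by (simp add: prod.list_conv_set_nth atLeast0LessThan)

section \<open>Error of one receiver in terms of its own marginal laws\<close>

lemma sum_swap_pairs:
  "(\<Sum>a\<in>A. \<Sum>b\<in>B. \<Sum>c\<in>C. \<Sum>d\<in>D. F a b c d) = (\<Sum>c\<in>C. \<Sum>d\<in>D. \<Sum>a\<in>A. \<Sum>b\<in>B. F a b c d)"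
  for F :: "'a \<Rightarrow> 'b \<Rightarrow> 'c \<Rightarrow> 'd \<Rightarrow> real"
  using sum.swap[of "\<lambda>x y. F (fst x) (snd x) (fst y) (snd y)" "C \<times> D" "A \<times> B"]
  by (simp only: sum.cartesian_product' fst_conv snd_conv)

text \<open>The decoder sees only projected words, so the hidden components are summed out
  letterwise. The observation becomes the outer sum because candidates compete with the observation
  held fixed.\<close>

lemma receiver_error_marginals:
  fixes P :: "'s::finite \<times> 't::finite \<times> 'u::finite \<Rightarrow> real" and W :: "'x \<Rightarrow> 'v \<Rightarrow> 'z::finite \<Rightarrow> real"
    and \<pi>w :: "'u \<Rightarrow> 'w::finite" and \<pi>y :: "'z \<Rightarrow> 'y::finite"
  shows "receiver_error P W \<pi>w \<pi>y m n f g d =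
    (\<Sum>ws\<in>seqs m. \<Sum>ys\<in>seqs n. \<Sum>ss\<in>seqs m. \<Sum>ts\<in>seqs m.
      (\<Prod>i<m. fiber_sum \<pi>w (\<lambda>u. P (ss ! i, ts ! i, u)) (ws ! i)) *
      (\<Prod>j<n. fiber_sum \<pi>y (W (f ss ! j) (g ts ! j)) (ys ! j)) * of_bool (d ys ws \<noteq> (ss, ts)))"
proof -
  let ?G = "\<lambda>ss ts ws. \<Sum>z\<in>seqs n. (\<Prod>j<n. W (f ss ! j) (g ts ! j) (z ! j)) *
        of_bool (d (map \<pi>y z) ws \<noteq> (ss, ts))"
  have G: "?G ss ts ws = (\<Sum>ys\<in>seqs n. (\<Prod>j<n. fiber_sum \<pi>y (W (f ss ! j) (g ts ! j)) (ys ! j)) *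
        of_bool (d ys ws \<noteq> (ss, ts)))" for ss ts ws
    unfolding fiber_sum_def
    by (rule sum_seqs_map[where G = "\<lambda>ys. of_bool (d ys ws \<noteq> (ss, ts))"])
  have "receiver_error P W \<pi>w \<pi>y m n f g d = (\<Sum>u\<in>seqs m. (\<Prod>i<m. P (u ! i)) *
      ?G (map fst u) (map (fst \<circ> snd) u) (map (\<pi>w \<circ> snd \<circ> snd) u))"
    unfolding receiver_error_def
    by (intro sum.cong refl) (simp add: prod_list_map_nth, simp add: seqs_def)
  also have "\<dots> = (\<Sum>ss\<in>seqs m. \<Sum>ts\<in>seqs m. \<Sum>us\<in>seqs m. (\<Prod>i<m. P (ss ! i, ts ! i, us ! i)) *
      ?G ss ts (map \<pi>w us))"
    unfolding sum_seqs_zip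
    by (intro sum.cong refl arg_cong2[of _ _ _ _ "(*)"] prod.cong)
      (auto simp: seqs_def map_map[symmetric] simp del: map_map)
  also have "\<dots> = (\<Sum>ss\<in>seqs m. \<Sum>ts\<in>seqs m. \<Sum>ws\<in>seqs m.
      (\<Prod>i<m. fiber_sum \<pi>w (\<lambda>u. P (ss ! i, ts ! i, u)) (ws ! i)) * ?G ss ts ws)"
    unfolding fiber_sum_def by (intro sum.cong refl sum_seqs_map)
  also have "\<dots> = (\<Sum>ss\<in>seqs m. \<Sum>ts\<in>seqs m. \<Sum>ws\<in>seqs m. \<Sum>ys\<in>seqs n.
      (\<Prod>i<m. fiber_sum \<pi>w (\<lambda>u. P (ss ! i, ts ! i, u)) (ws ! i)) *
      (\<Prod>j<n. fiber_sum \<pi>y (W (f ss ! j) (g ts ! j)) (ys ! j)) * of_bool (d ys ws \<noteq> (ss, ts)))"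
    unfolding G by (simp only: sum_distrib_left mult.assoc)
  also note sum_swap_pairs
  finally show ?thesis .
qed

lemma sum_letters_factor:
  fixes a :: "nat \<Rightarrow> 'a::finite \<Rightarrow> real" and b c :: "nat \<Rightarrow> 'b::finite \<Rightarrow> real"
  shows "(\<Sum>ss\<in>seqs m. \<Sum>xs\<in>seqs n. (\<Prod>j<n. c j (xs ! j)) * ((\<Prod>i<m. a i (ss ! i)) * (\<Prod>j<n. b j (xs ! j)))) =
    (\<Prod>i<m. \<Sum>s\<in>UNIV. a i s) * (\<Prod>j<n. \<Sum>x\<in>UNIV. c j x * b j x)"
proof -
  have "(\<Sum>ss\<in>seqs m. \<Sum>xs\<in>seqs n. (\<Prod>j<n. c j (xs ! j)) * ((\<Prod>i<m. a i (ss ! i)) * (\<Prod>j<n. b j (xs ! j)))) =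
     (\<Sum>ss\<in>seqs m. \<Prod>i<m. a i (ss ! i)) * (\<Sum>xs\<in>seqs n. \<Prod>j<n. c j (xs ! j) * b j (xs ! j))"
    by (simp only: sum_product prod.distrib mult_ac)
  then show ?thesis by (simp only: sum_seqs_prod[of a] sum_seqs_prod[of "\<lambda>j x. c j x * b j x"])
qed

lemma sum_source_marginal:
  fixes P :: "'s::finite \<times> 't::finite \<times> 'u::finite \<Rightarrow> real" and \<pi> :: "'u \<Rightarrow> 'w::finite"
  assumes "is_pmf UNIV P"
  shows "(\<Sum>w\<in>UNIV. \<Sum>s\<in>UNIV. \<Sum>t\<in>UNIV. fiber_sum \<pi> (\<lambda>u. P (s, t, u)) w) = 1"
proof -
  have "(\<Sum>w\<in>UNIV. \<Sum>s\<in>UNIV. \<Sum>t\<in>UNIV. fiber_sum \<pi> (\<lambda>u. P (s, t, u)) w) =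
      (\<Sum>s\<in>UNIV. \<Sum>t\<in>UNIV. \<Sum>w\<in>UNIV. fiber_sum \<pi> (\<lambda>u. P (s, t, u)) w * 1)"
    by (subst sum.swap, intro sum.cong refl, subst sum.swap) simp
  also have "\<dots> = (\<Sum>\<omega>\<in>UNIV. P \<omega>)"
    unfolding sum_fiber_sum by (simp add: sum.cartesian_product case_prod_unfold)
  finally show ?thesis using is_pmfD(3)[OF assms] by simp
qed

text \<open>\<open>random_code_error\<close> is applied to each observation \<open>ws\<close>,
  \<open>ys\<close> and the results are summed. The decoder may use both codebooks and
  \<open>qs\<close>, which are known to the receiver once the code is fixed.\<close>

lemma receiver_random_code:
  fixes P :: "'s::finite \<times> 't::finite \<times> 'u::finite \<Rightarrow> real" and W :: "'x::finite \<Rightarrow> 'v::finite \<Rightarrow> 'z::finite \<Rightarrow> real"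
    and \<pi>w :: "'u \<Rightarrow> 'w::finite" and \<pi>y :: "'z \<Rightarrow> 'y::finite"
  defines "p \<equiv> \<lambda>s t. fiber_sum \<pi>w (\<lambda>u. P (s, t, u))" and "V \<equiv> \<lambda>x v. fiber_sum \<pi>y (W x v)"
  assumes src: "is_pmf UNIV P" and chan: "\<And>x v. is_pmf UNIV (W x v)"
    and a: "\<And>q. q \<in> Q \<Longrightarrow> is_pmf UNIV (a q)" and b: "\<And>q. q \<in> Q \<Longrightarrow> is_pmf UNIV (b q)"
    and qs: "qs \<in> words Q n" and th: "0 < \<theta>"
  shows "\<exists>d. code_avg (seqs m) (seqs n) (\<lambda>xs. \<Prod>j<n. a (qs ! j) (xs ! j)) (\<lambda>f.
        code_avg (seqs m) (seqs n) (\<lambda>vs. \<Prod>j<n. b (qs ! j) (vs ! j)) (\<lambda>g.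
          receiver_error P W \<pi>w \<pi>y m n f g (d f g))) \<le>
      tail_prob p V (\<lambda>s t w. \<Sum>s\<in>UNIV. p s t w) (\<lambda>q x v y. \<Sum>x\<in>UNIV. a q x * V x v y) a b m n \<theta> qs +
      tail_prob p V (\<lambda>s t w. \<Sum>t\<in>UNIV. p s t w) (\<lambda>q x v y. \<Sum>v\<in>UNIV. b q v * V x v y) a b m n \<theta> qs +
      tail_prob p V (\<lambda>s t w. \<Sum>s\<in>UNIV. \<Sum>t\<in>UNIV. p s t w)
        (\<lambda>q x v y. \<Sum>x\<in>UNIV. \<Sum>v\<in>UNIV. a q x * b q v * V x v y) a b m n \<theta> qs +
      3 / \<theta>"
proof -
  note aD = is_pmfD[OF a[OF nth_words[OF qs]]] and bD = is_pmfD[OF b[OF nth_words[OF qs]]]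
  let ?a = "\<lambda>xs. \<Prod>j<n. a (qs ! j) (xs ! j)" and ?b = "\<lambda>vs. \<Prod>j<n. b (qs ! j) (vs ! j)"
  let ?L = "\<lambda>ss xs ts vs ws ys. (\<Prod>i<m. p (ss ! i) (ts ! i) (ws ! i)) * (\<Prod>j<n. V (xs ! j) (vs ! j) (ys ! j))"
  let ?M1 = "\<lambda>ts vs ws ys. (\<Prod>i<m. \<Sum>s\<in>UNIV. p s (ts ! i) (ws ! i)) *
     (\<Prod>j<n. \<Sum>x\<in>UNIV. a (qs ! j) x * V x (vs ! j) (ys ! j))"
  let ?M2 = "\<lambda>ss xs ws ys. (\<Prod>i<m. \<Sum>t\<in>UNIV. p (ss ! i) t (ws ! i)) *
     (\<Prod>j<n. \<Sum>v\<in>UNIV. b (qs ! j) v * V (xs ! j) v (ys ! j))"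
  let ?M0 = "\<lambda>ws ys. (\<Prod>i<m. \<Sum>s\<in>UNIV. \<Sum>t\<in>UNIV. p s t (ws ! i)) *
     (\<Prod>j<n. \<Sum>x\<in>UNIV. \<Sum>v\<in>UNIV. a (qs ! j) x * b (qs ! j) v * V x v (ys ! j))"
  let ?G = "\<lambda>ws ys ss xs ts vs. \<theta> * ?M1 ts vs ws ys \<le> ?L ss xs ts vs ws ys \<and>
     \<theta> * ?M2 ss xs ws ys \<le> ?L ss xs ts vs ws ys \<and> \<theta> * ?M0 ws ys \<le> ?L ss xs ts vs ws ys"
  define d where "d = (\<lambda>f g ys ws. threshold_decoder (seqs m) (seqs m) (?G ws ys) f g)"
  let ?T1 = "tail_prob p V (\<lambda>s t w. \<Sum>s\<in>UNIV. p s t w) (\<lambda>q x v y. \<Sum>x\<in>UNIV. a q x * V x v y) a b m n \<theta> qs"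
  let ?T2 = "tail_prob p V (\<lambda>s t w. \<Sum>t\<in>UNIV. p s t w) (\<lambda>q x v y. \<Sum>v\<in>UNIV. b q v * V x v y) a b m n \<theta> qs"
  let ?T0 = "tail_prob p V (\<lambda>s t w. \<Sum>s\<in>UNIV. \<Sum>t\<in>UNIV. p s t w)
        (\<lambda>q x v y. \<Sum>x\<in>UNIV. \<Sum>v\<in>UNIV. a q x * b q v * V x v y) a b m n \<theta> qs"
  have pmf: "is_pmf (seqs n) ?a" "is_pmf (seqs n) ?b"
    using a b nth_words[OF qs] by (auto simp: seqs_eq_words intro!: is_pmf_words)
  have p0: "0 \<le> p s t w" for s t w
    using is_pmfD(2)[OF src] by (auto simp: p_def intro: fiber_sum_nonneg)
  have V0: "0 \<le> V x v y" for x v y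
    using is_pmfD(2)[OF chan] by (auto simp: V_def intro: fiber_sum_nonneg)
  have V1: "(\<Sum>y\<in>UNIV. V x v y) = 1" for x v
    using sum_fiber_sum[of \<pi>y "W x v" "\<lambda>_. 1"] is_pmfD(3)[OF chan] by (simp add: V_def)
  have p1: "(\<Sum>w\<in>UNIV. \<Sum>s\<in>UNIV. \<Sum>t\<in>UNIV. p s t w) = 1"
    unfolding p_def by (rule sum_source_marginal[OF src])
  have L0: "0 \<le> ?L ss xs ts vs ws ys" for ss xs ts vs ws ys
    using p0 V0 by (intro mult_nonneg_nonneg prod_nonneg) auto
  have M1: "(\<Sum>ss\<in>seqs m. \<Sum>xs\<in>seqs n. ?a xs * ?L ss xs ts vs ws ys) = ?M1 ts vs ws ys" for ts vs ws ys
    by (rule sum_letters_factor[of "\<lambda>j. a (qs ! j)" n "\<lambda>i s. p s (ts ! i) (ws ! i)" m "\<lambda>j x. V x (vs ! j) (ys ! j)"])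
  have M2: "(\<Sum>ts\<in>seqs m. \<Sum>vs\<in>seqs n. ?b vs * ?L ss xs ts vs ws ys) = ?M2 ss xs ws ys" for ss xs ws ys
    by (rule sum_letters_factor[of "\<lambda>j. b (qs ! j)" n "\<lambda>i t. p (ss ! i) t (ws ! i)" m "\<lambda>j v. V (xs ! j) v (ys ! j)"])
  have M01: "(\<Sum>ts\<in>seqs m. \<Sum>vs\<in>seqs n. ?b vs * ?M1 ts vs ws ys) = ?M0 ws ys" for ws ys
  proof -
    have "(\<Sum>t\<in>UNIV. \<Sum>s\<in>UNIV. p s t w) = (\<Sum>s\<in>UNIV. \<Sum>t\<in>UNIV. p s t w)" for w
      by (rule sum.swap)
    moreover have "(\<Sum>v\<in>UNIV. b q v * (\<Sum>x\<in>UNIV. a q x * V x v y)) =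
        (\<Sum>x\<in>UNIV. \<Sum>v\<in>UNIV. a q x * b q v * V x v y)" for q y
      unfolding sum_distrib_left by (subst sum.swap) (simp only: mult_ac)
    ultimately show ?thesis
      using sum_letters_factor[of "\<lambda>j. b (qs ! j)" n "\<lambda>i t. \<Sum>s\<in>UNIV. p s t (ws ! i)" m
        "\<lambda>j v. \<Sum>x\<in>UNIV. a (qs ! j) x * V x v (ys ! j)"] by simp
  qed
  have M02: "(\<Sum>ss\<in>seqs m. \<Sum>xs\<in>seqs n. ?a xs * ?M2 ss xs ws ys) = ?M0 ws ys" for ws ys
    using sum_letters_factor[of "\<lambda>j. a (qs ! j)" n "\<lambda>i s. \<Sum>t\<in>UNIV. p s t (ws ! i)" m
        "\<lambda>j x. \<Sum>v\<in>UNIV. b (qs ! j) v * V x v (ys ! j)"] by (simp add: sum_distrib_left mult.assoc)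
  \<comment> \<open>The weights \<open>?M0\<close> form the law of the observation; with total 1
    they turn the confusion terms into \<open>3 / \<theta>\<close>.\<close>
  have tot: "(\<Sum>ws\<in>seqs m. \<Sum>ys\<in>seqs n. ?M0 ws ys) = 1"
  proof -
    have "(\<Sum>y\<in>UNIV. \<Sum>x\<in>UNIV. \<Sum>v\<in>UNIV. a (qs ! j) x * b (qs ! j) v * V x v y) = 1" if "j < n" for j
    proof -
      have "(\<Sum>y\<in>UNIV. \<Sum>x\<in>UNIV. \<Sum>v\<in>UNIV. a (qs ! j) x * b (qs ! j) v * V x v y) =
          (\<Sum>x\<in>UNIV. \<Sum>v\<in>UNIV. \<Sum>y\<in>UNIV. a (qs ! j) x * b (qs ! j) v * V x v y)"
        by (subst sum.swap, intro sum.cong refl, subst sum.swap, rule refl)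
      then show ?thesis
        using aD(3)[OF that] bD(3)[OF that] by (simp add: sum_distrib_left[symmetric] V1)
    qed
    then show ?thesis
      \<comment> \<open>With constant weight 1 the factorisation applies to the unweighted sum over
        source side information and output words.\<close>
      using sum_letters_factor[of "\<lambda>_ _. 1" n "\<lambda>i w. \<Sum>s\<in>UNIV. \<Sum>t\<in>UNIV. p s t w" m
        "\<lambda>j y. \<Sum>x\<in>UNIV. \<Sum>v\<in>UNIV. a (qs ! j) x * b (qs ! j) v * V x v y"] by (simp add: p1)
  qed
  have "code_avg (seqs m) (seqs n) ?a (\<lambda>f. code_avg (seqs m) (seqs n) ?b (\<lambda>g.
          receiver_error P W \<pi>w \<pi>y m n f g (d f g))) =
     (\<Sum>ws\<in>seqs m. \<Sum>ys\<in>seqs n. code_avg (seqs m) (seqs n) ?a (\<lambda>f. code_avg (seqs m) (seqs n) ?b (\<lambda>g.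
       \<Sum>ss\<in>seqs m. \<Sum>ts\<in>seqs m. ?L ss (f ss) ts (g ts) ws ys *
         of_bool (threshold_decoder (seqs m) (seqs m) (?G ws ys) f g \<noteq> (ss, ts)))))"
    by (simp only: receiver_error_marginals code_avg_sum d_def p_def V_def)
  also have "\<dots> \<le> (\<Sum>ws\<in>seqs m. \<Sum>ys\<in>seqs n.
      (\<Sum>ss\<in>seqs m. \<Sum>ts\<in>seqs m. \<Sum>xs\<in>seqs n. \<Sum>vs\<in>seqs n. ?a xs * ?b vs *
        (?L ss xs ts vs ws ys * of_bool (\<not> ?G ws ys ss xs ts vs))) + 3 * ?M0 ws ys / \<theta>)"
    by (intro sum_mono random_code_error[OF finite_seqs finite_seqs pmf L0 M1 M2 M01 M02 th refl])
  \<comment> \<open>Union bound: the true pair is rejected only if one of the three comparisons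
    fails.\<close>
  also have "\<dots> \<le> (\<Sum>ws\<in>seqs m. \<Sum>ys\<in>seqs n.
      (\<Sum>ss\<in>seqs m. \<Sum>ts\<in>seqs m. \<Sum>xs\<in>seqs n. \<Sum>vs\<in>seqs n.
        ?a xs * ?b vs * (?L ss xs ts vs ws ys * of_bool (?L ss xs ts vs ws ys < \<theta> * ?M1 ts vs ws ys)) +
        ?a xs * ?b vs * (?L ss xs ts vs ws ys * of_bool (?L ss xs ts vs ws ys < \<theta> * ?M2 ss xs ws ys)) +
        ?a xs * ?b vs * (?L ss xs ts vs ws ys * of_bool (?L ss xs ts vs ws ys < \<theta> * ?M0 ws ys))) +
      3 * ?M0 ws ys / \<theta>)"
  proof (intro sum_mono add_right_mono)
    fix ws ys ss ts and xs :: "'x list" and vs :: "'v list"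
    assume "xs \<in> seqs n" "vs \<in> seqs n"
    then have "0 \<le> ?a xs * ?b vs * ?L ss xs ts vs ws ys"
      using is_pmfD(2)[OF pmf(1)] is_pmfD(2)[OF pmf(2)] L0
      by (intro mult_nonneg_nonneg[OF mult_nonneg_nonneg L0]) auto
    then show "?a xs * ?b vs * (?L ss xs ts vs ws ys * of_bool (\<not> ?G ws ys ss xs ts vs)) \<le>
        ?a xs * ?b vs * (?L ss xs ts vs ws ys * of_bool (?L ss xs ts vs ws ys < \<theta> * ?M1 ts vs ws ys)) +
        ?a xs * ?b vs * (?L ss xs ts vs ws ys * of_bool (?L ss xs ts vs ws ys < \<theta> * ?M2 ss xs ws ys)) +
        ?a xs * ?b vs * (?L ss xs ts vs ws ys * of_bool (?L ss xs ts vs ws ys < \<theta> * ?M0 ws ys))"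
      unfolding mult.assoc[symmetric] by (auto simp: not_le)
  qed
  also have "\<dots> = ?T1 + ?T2 + ?T0 + (\<Sum>ws\<in>seqs m. \<Sum>ys\<in>seqs n. 3 * ?M0 ws ys / \<theta>)"
    unfolding tail_prob_def by (simp only: sum.distrib)
  also have "(\<Sum>ws\<in>seqs m. \<Sum>ys\<in>seqs n. 3 * ?M0 ws ys / \<theta>) = 3 * (\<Sum>ws\<in>seqs m. \<Sum>ys\<in>seqs n. ?M0 ws ys) / \<theta>"
    by (simp only: sum_divide_distrib[symmetric] sum_distrib_left[symmetric])
  finally show ?thesis unfolding tot by auto
qed

text \<open>The hypotheses are the entropy conditions for \<open>b = l / k\<close>, cleared of the
  denominator: both sides refer to one block, and \<tau> blocks are sent. The error is left
  averaged, without selecting a code, so that the second receiver's error can be added to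
  it.\<close>

lemma receiver_vanishing_error:
  fixes P :: "'s::finite \<times> 't::finite \<times> 'u::finite \<Rightarrow> real" and W :: "'x::finite \<Rightarrow> 'v::finite \<Rightarrow> 'z::finite \<Rightarrow> real"
    and \<pi>w :: "'u \<Rightarrow> 'w::finite" and \<pi>y :: "'z \<Rightarrow> 'y::finite"
    and Q :: "'q set" and pq :: "'q \<Rightarrow> real" and a :: "'q \<Rightarrow> 'x \<Rightarrow> real" and b :: "'q \<Rightarrow> 'v \<Rightarrow> real"
  defines "J \<equiv> \<lambda>(q, x, v, y). pq q * a q x * b q v * W x v y"
  assumes src: "is_pmf UNIV P" and chan: "\<And>x v. is_pmf UNIV (W x v)" and pq: "is_pmf Q pq"
    and a: "\<And>q. q \<in> Q \<Longrightarrow> is_pmf UNIV (a q)" and b: "\<And>q. q \<in> Q \<Longrightarrow> is_pmf UNIV (b q)"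
    and H1: "real k * cond_entropy UNIV P fst (\<lambda>\<omega>. (fst (snd \<omega>), \<pi>w (snd (snd \<omega>)))) <
      real l * cond_mutual_info (Q \<times> UNIV) J (\<lambda>\<omega>. fst (snd \<omega>)) (\<lambda>\<omega>. \<pi>y (snd (snd (snd \<omega>))))
        (\<lambda>\<omega>. (fst (snd (snd \<omega>)), fst \<omega>))"
    and H2: "real k * cond_entropy UNIV P (\<lambda>\<omega>. fst (snd \<omega>)) (\<lambda>\<omega>. (fst \<omega>, \<pi>w (snd (snd \<omega>)))) <
      real l * cond_mutual_info (Q \<times> UNIV) J (\<lambda>\<omega>. fst (snd (snd \<omega>))) (\<lambda>\<omega>. \<pi>y (snd (snd (snd \<omega>))))
        (\<lambda>\<omega>. (fst (snd \<omega>), fst \<omega>))"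
    and H0: "real k * cond_entropy UNIV P (\<lambda>\<omega>. (fst \<omega>, fst (snd \<omega>))) (\<lambda>\<omega>. \<pi>w (snd (snd \<omega>))) <
      real l * cond_mutual_info (Q \<times> UNIV) J (\<lambda>\<omega>. (fst (snd \<omega>), fst (snd (snd \<omega>))))
        (\<lambda>\<omega>. \<pi>y (snd (snd (snd \<omega>)))) fst"
  obtains E d where "E \<longlonglongrightarrow> (0 :: real)"
    "\<And>\<tau>. (\<Sum>qs\<in>words Q (l * \<tau>). (\<Prod>j<l * \<tau>. pq (qs ! j)) *
      code_avg (seqs (k * \<tau>)) (seqs (l * \<tau>)) (\<lambda>xs. \<Prod>j<l * \<tau>. a (qs ! j) (xs ! j)) (\<lambda>f.
        code_avg (seqs (k * \<tau>)) (seqs (l * \<tau>)) (\<lambda>vs. \<Prod>j<l * \<tau>. b (qs ! j) (vs ! j)) (\<lambda>g.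
          receiver_error P W \<pi>w \<pi>y (k * \<tau>) (l * \<tau>) f g (d \<tau> qs f g)))) \<le> E \<tau>"
proof -
  define p where "p = (\<lambda>s t. fiber_sum \<pi>w (\<lambda>u. P (s, t, u)))"
  define V where "V = (\<lambda>x v. fiber_sum \<pi>y (W x v))"
  have p_eq: "fiber_sum \<pi>w (\<lambda>u. P (s, t, u)) = p s t" and V_eq: "fiber_sum \<pi>y (W x v) = V x v" for s t x v
    by (simp_all add: p_def V_def)
  have p0: "0 \<le> p s t w" for s t w
    using is_pmfD(2)[OF src] by (auto simp: p_def intro: fiber_sum_nonneg)
  have V0: "0 \<le> V x v y" for x v y
    using is_pmfD(2)[OF chan] by (auto simp: V_def intro: fiber_sum_nonneg)
  have V1: "(\<Sum>y\<in>UNIV. V x v y) = 1" for x v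
    using sum_fiber_sum[of \<pi>y "W x v" "\<lambda>_. 1"] is_pmfD(3)[OF chan] by (simp add: V_def)
  have p1: "(\<Sum>w\<in>UNIV. \<Sum>s\<in>UNIV. \<Sum>t\<in>UNIV. p s t w) = 1"
    unfolding p_def by (rule sum_source_marginal[OF src])
  let ?M1 = "\<lambda>s t w. \<Sum>s\<in>UNIV. p s t w" and ?M2 = "\<lambda>s t w. \<Sum>t\<in>UNIV. p s t w"
    and ?M0 = "\<lambda>s t w. \<Sum>s\<in>UNIV. \<Sum>t\<in>UNIV. p s t w"
  let ?N1 = "\<lambda>q x v y. \<Sum>x\<in>UNIV. a q x * V x v y" and ?N2 = "\<lambda>q x v y. \<Sum>v\<in>UNIV. b q v * V x v y"
    and ?N0 = "\<lambda>q x v y. \<Sum>x\<in>UNIV. \<Sum>v\<in>UNIV. a q x * b q v * V x v y"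
  let ?A = "\<lambda>M. \<Sum>w\<in>UNIV. \<Sum>s\<in>UNIV. \<Sum>t\<in>UNIV. p s t w * ln (M s t w / p s t w)"
  let ?B = "\<lambda>N. \<Sum>q\<in>Q. \<Sum>y\<in>UNIV. \<Sum>x\<in>UNIV. \<Sum>v\<in>UNIV. pq q * a q x * b q v * V x v y * ln (N q x v y / V x v y)"
  let ?gap = "\<lambda>M N. real k * ?A M + real l * ?B N"
  have M: "0 < ?M1 s t w" "0 < ?M2 s t w" "0 < ?M0 s t w" if "p s t w \<noteq> 0" for s t w
  proof -
    have pos: "0 < p s t w" using that p0[of s t w] by simp
    show "0 < ?M1 s t w" "0 < ?M2 s t w"
      using pos p0 by (auto intro!: sum_pos2[of _ s] sum_pos2[of _ t])
    show "0 < ?M0 s t w"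
      using pos p0 by (auto intro!: sum_pos2[of _ s] sum_pos2[of _ t] sum_nonneg)
  qed
  have N: "0 < ?N1 q x v y" "0 < ?N2 q x v y" "0 < ?N0 q x v y"
    if q: "q \<in> Q" and nz: "pq q * a q x * b q v * V x v y \<noteq> 0" for q x v y
  proof -
    note nn = is_pmfD(2)[OF a[OF q] UNIV_I] is_pmfD(2)[OF b[OF q] UNIV_I] V0
    have pos: "0 < a q x" "0 < b q v" "0 < V x v y"
      using nz nn(1)[of x] nn(2)[of v] nn(3)[of x v y] by (auto simp: less_le)
    show "0 < ?N1 q x v y" "0 < ?N2 q x v y"
      using pos nn by (auto intro!: sum_pos2[of _ x] sum_pos2[of _ v])
    show "0 < ?N0 q x v y"
      using pos nn by (auto intro!: sum_pos2[of _ x] sum_pos2[of _ v] sum_nonneg)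
  qed
  \<comment> \<open>Turns a condition in bits into a negative exponent in nats; the minus sign in
    \<open>i * ln 2 = - B\<close> is that of \<open>channel_infos\<close>.\<close>
  have scale: "real k * (h * ln 2) + real l * B < 0" if "real k * h < real l * i" "i * ln 2 = - B" for h i B :: real
  proof -
    have "real k * h * ln 2 < real l * i * ln 2" using that(1) by simp
    then have "real k * (h * ln 2) < real l * (i * ln 2)" by (simp only: mult.assoc)
    then show ?thesis by (simp add: that(2))
  qed
  note infos = channel_infos[where \<pi> = \<pi>y and W = W and p = a and r = b, OF chan pq a b, folded J_def, unfolded V_eq]
  note ents = source_entropies[of P \<pi>w, unfolded p_eq]
  have "?gap ?M1 ?N1 < 0" using scale[OF H1 infos(1)] unfolding ents .
  moreover have "?gap ?M2 ?N2 < 0" using scale[OF H2 infos(2)] unfolding ents .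
  moreover have "?gap ?M0 ?N0 < 0" using scale[OF H0 infos(3)] unfolding ents .
  ultimately have g: "?gap ?M1 ?N1 < 0" "?gap ?M2 ?N2 < 0" "?gap ?M0 ?N0 < 0" by simp_all
  \<comment> \<open>Half of the smallest slack: \<open>exp (c * real \<tau>)\<close> grows
    exponentially, yet every gap stays negative after \<open>c\<close> is added.\<close>
  define c where "c = - Max {?gap ?M1 ?N1, ?gap ?M2 ?N2, ?gap ?M0 ?N0} / 2"
  have "Max {?gap ?M1 ?N1, ?gap ?M2 ?N2, ?gap ?M0 ?N0} < 0" using g by simp
  moreover have "?gap ?M1 ?N1 \<le> Max {?gap ?M1 ?N1, ?gap ?M2 ?N2, ?gap ?M0 ?N0}"
    "?gap ?M2 ?N2 \<le> Max {?gap ?M1 ?N1, ?gap ?M2 ?N2, ?gap ?M0 ?N0}"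
    "?gap ?M0 ?N0 \<le> Max {?gap ?M1 ?N1, ?gap ?M2 ?N2, ?gap ?M0 ?N0}" by (intro Max_ge; simp)+
  ultimately have c: "0 < c" "?gap ?M1 ?N1 + c < 0" "?gap ?M2 ?N2 + c < 0" "?gap ?M0 ?N0 + c < 0"
    unfolding c_def by linarith+
  let ?T = "\<lambda>M N \<tau> qs. tail_prob p V M N a b (k * \<tau>) (l * \<tau>) (exp (c * real \<tau>)) qs"
  have tail: "\<exists>\<rho>. 0 \<le> \<rho> \<and> \<rho> < 1 \<and>
      (\<forall>\<tau>. (\<Sum>qs\<in>words Q (l * \<tau>). (\<Prod>j<l * \<tau>. pq (qs ! j)) * ?T M N \<tau> qs) \<le> \<rho> ^ \<tau>)"
    if M: "\<And>s t w. p s t w \<noteq> 0 \<Longrightarrow> 0 < M s t w"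
      and N: "\<And>q x v y. q \<in> Q \<Longrightarrow> pq q * a q x * b q v * V x v y \<noteq> 0 \<Longrightarrow> 0 < N q x v y"
      and gap: "?gap M N + c < 0" for M N
  proof -
    obtain \<rho> where "0 \<le> \<rho>" "\<rho> < 1" "\<And>\<tau> m n. m = k * \<tau> \<Longrightarrow> n = l * \<tau> \<Longrightarrow>
        (\<Sum>qs\<in>words Q n. (\<Prod>j<n. pq (qs ! j)) * tail_prob p V M N a b m n (exp (c * real \<tau>)) qs) \<le> \<rho> ^ \<tau>"
      by (rule tail_bound[where P = p and V = V and M = M and N = N and p = a and r = b,
            OF p0 p1 M V0 V1 pq a b N gap]) (assumption | rule that | blast)+
    then show ?thesis by (intro exI[of _ \<rho>]) simp
  qed
  have "\<exists>\<rho>. 0 \<le> \<rho> \<and> \<rho> < 1 \<and>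
      (\<forall>\<tau>. (\<Sum>qs\<in>words Q (l * \<tau>). (\<Prod>j<l * \<tau>. pq (qs ! j)) * ?T ?M1 ?N1 \<tau> qs) \<le> \<rho> ^ \<tau>)"
    by (rule tail[of ?M1 ?N1, OF _ _ c(2)]) (rule M N, assumption+)+
  then obtain \<rho>1 where r1: "0 \<le> \<rho>1" "\<rho>1 < 1"
      "\<And>\<tau>. (\<Sum>qs\<in>words Q (l * \<tau>). (\<Prod>j<l * \<tau>. pq (qs ! j)) * ?T ?M1 ?N1 \<tau> qs) \<le> \<rho>1 ^ \<tau>"
    by (elim exE conjE) (rule that, assumption, assumption, rule spec)
  have "\<exists>\<rho>. 0 \<le> \<rho> \<and> \<rho> < 1 \<and>
      (\<forall>\<tau>. (\<Sum>qs\<in>words Q (l * \<tau>). (\<Prod>j<l * \<tau>. pq (qs ! j)) * ?T ?M2 ?N2 \<tau> qs) \<le> \<rho> ^ \<tau>)"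
    by (rule tail[of ?M2 ?N2, OF _ _ c(3)]) (rule M N, assumption+)+
  then obtain \<rho>2 where r2: "0 \<le> \<rho>2" "\<rho>2 < 1"
      "\<And>\<tau>. (\<Sum>qs\<in>words Q (l * \<tau>). (\<Prod>j<l * \<tau>. pq (qs ! j)) * ?T ?M2 ?N2 \<tau> qs) \<le> \<rho>2 ^ \<tau>"
    by (elim exE conjE) (rule that, assumption, assumption, rule spec)
  have "\<exists>\<rho>. 0 \<le> \<rho> \<and> \<rho> < 1 \<and>
      (\<forall>\<tau>. (\<Sum>qs\<in>words Q (l * \<tau>). (\<Prod>j<l * \<tau>. pq (qs ! j)) * ?T ?M0 ?N0 \<tau> qs) \<le> \<rho> ^ \<tau>)"
    by (rule tail[of ?M0 ?N0, OF _ _ c(4)]) (rule M N, assumption+)+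
  then obtain \<rho>0 where r0: "0 \<le> \<rho>0" "\<rho>0 < 1"
      "\<And>\<tau>. (\<Sum>qs\<in>words Q (l * \<tau>). (\<Prod>j<l * \<tau>. pq (qs ! j)) * ?T ?M0 ?N0 \<tau> qs) \<le> \<rho>0 ^ \<tau>"
    by (elim exE conjE) (rule that, assumption, assumption, rule spec)
  let ?R = "\<lambda>\<tau> qs d. code_avg (seqs (k * \<tau>)) (seqs (l * \<tau>)) (\<lambda>xs. \<Prod>j<l * \<tau>. a (qs ! j) (xs ! j)) (\<lambda>f.
        code_avg (seqs (k * \<tau>)) (seqs (l * \<tau>)) (\<lambda>vs. \<Prod>j<l * \<tau>. b (qs ! j) (vs ! j)) (\<lambda>g.
          receiver_error P W \<pi>w \<pi>y (k * \<tau>) (l * \<tau>) f g (d f g)))"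
  let ?S = "\<lambda>\<tau> qs. ?T ?M1 ?N1 \<tau> qs + ?T ?M2 ?N2 \<tau> qs + ?T ?M0 ?N0 \<tau> qs + 3 / exp (c * real \<tau>)"
  have ex: "\<exists>d. ?R \<tau> qs d \<le> ?S \<tau> qs" if "qs \<in> words Q (l * \<tau>)" for \<tau> qs
    unfolding p_def V_def by (rule receiver_random_code[OF src chan a b that]) simp_all
  \<comment> \<open>A decoder is known to exist for each \<open>qs\<close> separately; choice makes
    one family of them, over which the time-sharing words can be averaged.\<close>
  define d where "d \<tau> qs = (SOME d. ?R \<tau> qs d \<le> ?S \<tau> qs)" for \<tau> qs
  have d: "?R \<tau> qs (d \<tau> qs) \<le> ?S \<tau> qs" if "qs \<in> words Q (l * \<tau>)" for \<tau> qs
    unfolding d_def by (rule someI_ex[OF ex[OF that]])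
  show thesis
  proof (rule that[of "\<lambda>\<tau>. \<rho>1 ^ \<tau> + \<rho>2 ^ \<tau> + \<rho>0 ^ \<tau> + 3 * exp (- c) ^ \<tau>" d])
    have "(\<lambda>\<tau>. \<rho>1 ^ \<tau> + \<rho>2 ^ \<tau> + \<rho>0 ^ \<tau> + 3 * exp (- c) ^ \<tau>) \<longlonglongrightarrow> 0 + 0 + 0 + 3 * 0"
      using r1 r2 r0 c by (intro tendsto_intros LIMSEQ_power_zero) auto
    then show "(\<lambda>\<tau>. \<rho>1 ^ \<tau> + \<rho>2 ^ \<tau> + \<rho>0 ^ \<tau> + 3 * exp (- c) ^ \<tau>) \<longlonglongrightarrow> 0" by simp
    fix \<tau>
    let ?w = "\<lambda>qs. \<Prod>j<l * \<tau>. pq (qs ! j)"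
    have pmf: "is_pmf (words Q (l * \<tau>)) ?w"
      using pq is_pmfD(1)[OF pq] by (intro is_pmf_words) auto
    have "(\<Sum>qs\<in>words Q (l * \<tau>). ?w qs * ?R \<tau> qs (d \<tau> qs)) \<le> (\<Sum>qs\<in>words Q (l * \<tau>). ?w qs *
       (?T ?M1 ?N1 \<tau> qs + ?T ?M2 ?N2 \<tau> qs + ?T ?M0 ?N0 \<tau> qs + 3 / exp (c * real \<tau>)))"
      using d is_pmfD(2)[OF pmf] by (intro sum_mono mult_left_mono) auto
    also have "\<dots> = (\<Sum>qs\<in>words Q (l * \<tau>). ?w qs * ?T ?M1 ?N1 \<tau> qs) + (\<Sum>qs\<in>words Q (l * \<tau>). ?w qs * ?T ?M2 ?N2 \<tau> qs) +
        (\<Sum>qs\<in>words Q (l * \<tau>). ?w qs * ?T ?M0 ?N0 \<tau> qs) + 3 / exp (c * real \<tau>)"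
      by (simp only: distrib_left sum.distrib sum_distrib_right[symmetric] is_pmfD(3)[OF pmf] mult_1)
    also have "\<dots> \<le> \<rho>1 ^ \<tau> + \<rho>2 ^ \<tau> + \<rho>0 ^ \<tau> + 3 / exp (c * real \<tau>)"
      by (intro add_mono r1(3) r2(3) r0(3) order_refl)
    also have "3 / exp (c * real \<tau>) = 3 * exp (- c) ^ \<tau>"
      by (simp add: exp_minus power_inverse exp_of_nat_mult[symmetric] mult.commute divide_inverse)
    finally show "(\<Sum>qs\<in>words Q (l * \<tau>). ?w qs * ?R \<tau> qs (d \<tau> qs)) \<le>
        \<rho>1 ^ \<tau> + \<rho>2 ^ \<tau> + \<rho>0 ^ \<tau> + 3 * exp (- c) ^ \<tau>" .
  qed
qed

section \<open>Combining the two receivers and extracting a deterministic code\<close>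

lemma mac_error_prob_le_receivers:
  fixes Psrc :: "('s1::finite \<times> 's2::finite \<times> 'w1::finite \<times> 'w2::finite) \<Rightarrow> real"
    and W :: "'x1::finite \<Rightarrow> 'x2::finite \<Rightarrow> ('y1::finite \<times> 'y2::finite) \<Rightarrow> real"
  assumes "is_pmf UNIV Psrc" "\<And>x v. is_pmf UNIV (W x v)"
  shows "mac_error_prob Psrc W m n f1 f2 g1 g2 \<le>
    receiver_error Psrc W fst fst m n f1 f2 g1 + receiver_error Psrc W snd snd m n f1 f2 g2"
proof -
  have P: "0 \<le> prod_list (map Psrc u)" for u
    using is_pmfD(2)[OF assms(1)] by (simp add: prod_list_map_nth prod_nonneg)
  have W: "0 \<le> (\<Prod>j<n. W (x ! j) (v ! j) (y ! j))" for x v y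
    using is_pmfD(2)[OF assms(2)] by (simp add: prod_nonneg)
  have "c * (if A \<or> B then 1 else 0) \<le> c * of_bool A + c * of_bool B" if "0 \<le> c" for c :: real and A B
    using that by simp
  then show ?thesis
    unfolding mac_error_prob_def receiver_error_def sum.distrib[symmetric] distrib_left[symmetric] Let_def
    by (intro sum_mono mult_left_mono P) (auto simp: W comp_assoc)
qed

theorem theorem5:
  fixes Psrc :: "('s1::finite \<times> 's2::finite \<times> 'w1::finite \<times> 'w2::finite) \<Rightarrow> real"
    and W :: "'x1::finite \<Rightarrow> 'x2::finite \<Rightarrow> ('y1::finite \<times> 'y2::finite) \<Rightarrow> real"
    and b :: real
  assumes src: "is_pmf UNIV Psrc"
    and chan: "\<forall>x1 x2. is_pmf UNIV (W x1 x2)"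
    and rat: "b \<in> \<rat>"
    and cond: "\<exists>(Q :: nat set) (pq :: nat \<Rightarrow> real) (px1 :: nat \<Rightarrow> 'x1 \<Rightarrow> real) (px2 :: nat \<Rightarrow> 'x2 \<Rightarrow> real).
       finite Q \<and> card Q \<le> 4 \<and> is_pmf Q pq \<and>
       (\<forall>q\<in>Q. is_pmf UNIV (px1 q)) \<and> (\<forall>q\<in>Q. is_pmf UNIV (px2 q)) \<and>
       (let \<Omega> = (Q \<times> UNIV :: (nat \<times> 'x1 \<times> 'x2 \<times> 'y1 \<times> 'y2) set);
            J = (\<lambda>(q, x1, x2, y). pq q * px1 q x1 * px2 q x2 * W x1 x2 y);
            Qv = (\<lambda>(q, x1, x2, y1, y2). q);
            X1 = (\<lambda>(q, x1, x2, y1, y2). x1);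
            X2 = (\<lambda>(q, x1, x2, y1, y2). x2);
            Y1 = (\<lambda>(q, x1, x2, y1, y2). y1);
            Y2 = (\<lambda>(q, x1, x2, y1, y2). y2);
            S1 = (\<lambda>(s1 :: 's1, s2 :: 's2, w1 :: 'w1, w2 :: 'w2). s1);
            S2 = (\<lambda>(s1 :: 's1, s2 :: 's2, w1 :: 'w1, w2 :: 'w2). s2);
            W1 = (\<lambda>(s1 :: 's1, s2 :: 's2, w1 :: 'w1, w2 :: 'w2). w1);
            W2 = (\<lambda>(s1 :: 's1, s2 :: 's2, w1 :: 'w1, w2 :: 'w2). w2)
        in cond_entropy UNIV Psrc S1 (\<lambda>\<omega>. (S2 \<omega>, W1 \<omega>))
             < b * cond_mutual_info \<Omega> J X1 Y1 (\<lambda>\<omega>. (X2 \<omega>, Qv \<omega>)) \<and>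
           cond_entropy UNIV Psrc S2 (\<lambda>\<omega>. (S1 \<omega>, W1 \<omega>))
             < b * cond_mutual_info \<Omega> J X2 Y1 (\<lambda>\<omega>. (X1 \<omega>, Qv \<omega>)) \<and>
           cond_entropy UNIV Psrc (\<lambda>\<omega>. (S1 \<omega>, S2 \<omega>)) W1
             < b * cond_mutual_info \<Omega> J (\<lambda>\<omega>. (X1 \<omega>, X2 \<omega>)) Y1 Qv \<and>
           cond_entropy UNIV Psrc S1 (\<lambda>\<omega>. (S2 \<omega>, W2 \<omega>))
             < b * cond_mutual_info \<Omega> J X1 Y2 (\<lambda>\<omega>. (X2 \<omega>, Qv \<omega>)) \<and>
           cond_entropy UNIV Psrc S2 (\<lambda>\<omega>. (S1 \<omega>, W2 \<omega>))
             < b * cond_mutual_info \<Omega> J X2 Y2 (\<lambda>\<omega>. (X1 \<omega>, Qv \<omega>)) \<and>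
           cond_entropy UNIV Psrc (\<lambda>\<omega>. (S1 \<omega>, S2 \<omega>)) W2
             < b * cond_mutual_info \<Omega> J (\<lambda>\<omega>. (X1 \<omega>, X2 \<omega>)) Y2 Qv)"
  shows "achievable_rate Psrc W b"
proof -
  have chan': "is_pmf UNIV (W x v)" for x v using chan by blast
  obtain Q :: "nat set" and pq px1 px2 where pq: "is_pmf Q pq"
    and px1: "\<And>q. q \<in> Q \<Longrightarrow> is_pmf UNIV (px1 q)" and px2: "\<And>q. q \<in> Q \<Longrightarrow> is_pmf UNIV (px2 q)"
    and rates:
      "cond_entropy UNIV Psrc fst (\<lambda>\<omega>. (fst (snd \<omega>), fst (snd (snd \<omega>)))) <
        b * cond_mutual_info (Q \<times> UNIV) (\<lambda>(q, x1, x2, y). pq q * px1 q x1 * px2 q x2 * W x1 x2 y)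
          (\<lambda>\<omega>. fst (snd \<omega>)) (\<lambda>\<omega>. fst (snd (snd (snd \<omega>)))) (\<lambda>\<omega>. (fst (snd (snd \<omega>)), fst \<omega>))"
      "cond_entropy UNIV Psrc (\<lambda>\<omega>. fst (snd \<omega>)) (\<lambda>\<omega>. (fst \<omega>, fst (snd (snd \<omega>)))) <
        b * cond_mutual_info (Q \<times> UNIV) (\<lambda>(q, x1, x2, y). pq q * px1 q x1 * px2 q x2 * W x1 x2 y)
          (\<lambda>\<omega>. fst (snd (snd \<omega>))) (\<lambda>\<omega>. fst (snd (snd (snd \<omega>)))) (\<lambda>\<omega>. (fst (snd \<omega>), fst \<omega>))"
      "cond_entropy UNIV Psrc (\<lambda>\<omega>. (fst \<omega>, fst (snd \<omega>))) (\<lambda>\<omega>. fst (snd (snd \<omega>))) <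
        b * cond_mutual_info (Q \<times> UNIV) (\<lambda>(q, x1, x2, y). pq q * px1 q x1 * px2 q x2 * W x1 x2 y)
          (\<lambda>\<omega>. (fst (snd \<omega>), fst (snd (snd \<omega>)))) (\<lambda>\<omega>. fst (snd (snd (snd \<omega>)))) fst"
      "cond_entropy UNIV Psrc fst (\<lambda>\<omega>. (fst (snd \<omega>), snd (snd (snd \<omega>)))) <
        b * cond_mutual_info (Q \<times> UNIV) (\<lambda>(q, x1, x2, y). pq q * px1 q x1 * px2 q x2 * W x1 x2 y)
          (\<lambda>\<omega>. fst (snd \<omega>)) (\<lambda>\<omega>. snd (snd (snd (snd \<omega>)))) (\<lambda>\<omega>. (fst (snd (snd \<omega>)), fst \<omega>))"
      "cond_entropy UNIV Psrc (\<lambda>\<omega>. fst (snd \<omega>)) (\<lambda>\<omega>. (fst \<omega>, snd (snd (snd \<omega>)))) <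
        b * cond_mutual_info (Q \<times> UNIV) (\<lambda>(q, x1, x2, y). pq q * px1 q x1 * px2 q x2 * W x1 x2 y)
          (\<lambda>\<omega>. fst (snd (snd \<omega>))) (\<lambda>\<omega>. snd (snd (snd (snd \<omega>)))) (\<lambda>\<omega>. (fst (snd \<omega>), fst \<omega>))"
      "cond_entropy UNIV Psrc (\<lambda>\<omega>. (fst \<omega>, fst (snd \<omega>))) (\<lambda>\<omega>. snd (snd (snd \<omega>))) <
        b * cond_mutual_info (Q \<times> UNIV) (\<lambda>(q, x1, x2, y). pq q * px1 q x1 * px2 q x2 * W x1 x2 y)
          (\<lambda>\<omega>. (fst (snd \<omega>), fst (snd (snd \<omega>)))) (\<lambda>\<omega>. snd (snd (snd (snd \<omega>)))) fst"
    using cond unfolding Let_def case_prod_unfold by blast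
  \<comment> \<open>The entropy is nonnegative and the condition strict, so \<open>b\<close> times a
    nonnegative information is positive. This makes the numerator \<open>l\<close>, and with it the
    channel length, positive.\<close>
  have "0 < b"
  proof -
    have "0 < b * cond_mutual_info (Q \<times> UNIV) (\<lambda>(q, x1, x2, y). pq q * px1 q x1 * px2 q x2 * W x1 x2 y)
          (\<lambda>\<omega>. fst (snd \<omega>)) (\<lambda>\<omega>. fst (snd (snd (snd \<omega>)))) (\<lambda>\<omega>. (fst (snd (snd \<omega>)), fst \<omega>))"
      using rates(1) cond_entropy_nonneg[OF src] by (rule le_less_trans[rotated])
    then show ?thesis
      using channel_info_nonneg[where \<pi> = fst and W = W and p = px1 and r = px2, OF chan' pq px1 px2] by (simp add: zero_less_mult_iff)
  qed
  \<comment> \<open>The rate has to be met exactly: the lengths \<open>k * \<tau>\<close> and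
    \<open>l * \<tau>\<close> keep their quotient at \<open>b\<close> while \<tau> grows.\<close>
  then obtain l k :: nat where k: "0 < k" and l: "0 < l" and b: "b = real l / real k"
    using Rats_abs_nat_div_natE[OF rat] by (metis abs_of_pos bot_nat_0.not_eq_extremum div_0 less_irrefl of_nat_0)
  have scale: "real k * h < real l * i" if "h < b * i" for h i
    using that k by (simp add: b field_simps)
  obtain E1 d1 where E1: "E1 \<longlonglongrightarrow> (0 :: real)" and d1:
    "\<And>\<tau>. (\<Sum>qs\<in>words Q (l * \<tau>). (\<Prod>j<l * \<tau>. pq (qs ! j)) *
      code_avg (seqs (k * \<tau>)) (seqs (l * \<tau>)) (\<lambda>xs. \<Prod>j<l * \<tau>. px1 (qs ! j) (xs ! j)) (\<lambda>f.
        code_avg (seqs (k * \<tau>)) (seqs (l * \<tau>)) (\<lambda>vs. \<Prod>j<l * \<tau>. px2 (qs ! j) (vs ! j)) (\<lambda>g.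
          receiver_error Psrc W fst fst (k * \<tau>) (l * \<tau>) f g (d1 \<tau> qs f g)))) \<le> E1 \<tau>"
    using receiver_vanishing_error[OF src chan' pq px1 px2 scale[OF rates(1)] scale[OF rates(2)] scale[OF rates(3)]]
    by blast
  obtain E2 d2 where E2: "E2 \<longlonglongrightarrow> (0 :: real)" and d2:
    "\<And>\<tau>. (\<Sum>qs\<in>words Q (l * \<tau>). (\<Prod>j<l * \<tau>. pq (qs ! j)) *
      code_avg (seqs (k * \<tau>)) (seqs (l * \<tau>)) (\<lambda>xs. \<Prod>j<l * \<tau>. px1 (qs ! j) (xs ! j)) (\<lambda>f.
        code_avg (seqs (k * \<tau>)) (seqs (l * \<tau>)) (\<lambda>vs. \<Prod>j<l * \<tau>. px2 (qs ! j) (vs ! j)) (\<lambda>g.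
          receiver_error Psrc W snd snd (k * \<tau>) (l * \<tau>) f g (d2 \<tau> qs f g)))) \<le> E2 \<tau>"
    using receiver_vanishing_error[OF src chan' pq px1 px2 scale[OF rates(4)] scale[OF rates(5)] scale[OF rates(6)]]
    by blast
  show ?thesis
    unfolding achievable_rate_def
  proof (intro allI impI)
    fix \<epsilon> :: real assume "0 < \<epsilon>"
    moreover have "(\<lambda>\<tau>. E1 \<tau> + E2 \<tau>) \<longlonglongrightarrow> 0" using tendsto_add[OF E1 E2] by simp
    \<comment> \<open>\<open>0 < \<tau>\<close> keeps both block lengths positive.\<close>
    ultimately have "\<forall>\<^sub>F \<tau> in sequentially. E1 \<tau> + E2 \<tau> < \<epsilon> \<and> 0 < \<tau>"
      by (intro eventually_conj order_tendstoD(2) eventually_gt_at_top)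
    then obtain \<tau> where \<tau>: "E1 \<tau> + E2 \<tau> < \<epsilon>" "0 < \<tau>"
      by (auto simp: eventually_at_top_linorder)
    let ?m = "k * \<tau>" and ?n = "l * \<tau>"
    let ?a = "\<lambda>qs xs. \<Prod>j<?n. px1 (qs ! j) (xs ! j)" and ?b = "\<lambda>qs vs. \<Prod>j<?n. px2 (qs ! j) (vs ! j)"
    \<comment> \<open>Both decoders are functions of the same codebooks, so one choice of
      \<open>f\<close> and \<open>g\<close> that makes this sum small serves both receivers.\<close>
    let ?e = "\<lambda>qs f g. receiver_error Psrc W fst fst ?m ?n f g (d1 \<tau> qs f g) +
       receiver_error Psrc W snd snd ?m ?n f g (d2 \<tau> qs f g)"
    have pmfq: "is_pmf (words Q ?n) (\<lambda>qs. \<Prod>j<?n. pq (qs ! j))"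
      using pq is_pmfD(1)[OF pq] by (intro is_pmf_words) auto
    have "(\<Sum>qs\<in>words Q ?n. (\<Prod>j<?n. pq (qs ! j)) * code_avg (seqs ?m) (seqs ?n) (?a qs) (\<lambda>f.
        code_avg (seqs ?m) (seqs ?n) (?b qs) (\<lambda>g. ?e qs f g))) < \<epsilon>"
      using d1[of \<tau>] d2[of \<tau>] \<tau>(1) by (simp add: code_avg_add distrib_left sum.distrib)
    \<comment> \<open>An average below \<epsilon> has a term below \<epsilon>: the time-sharing
      word, then \<open>f\<close>, then \<open>g\<close> are fixed in turn.\<close>
    then obtain qs where qs: "qs \<in> words Q ?n"
      "code_avg (seqs ?m) (seqs ?n) (?a qs) (\<lambda>f. code_avg (seqs ?m) (seqs ?n) (?b qs) (\<lambda>g. ?e qs f g)) < \<epsilon>"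
      by (rule pmf_avg_less_witness[OF pmfq])
    have pmf: "is_pmf (seqs ?n) (?a qs)" "is_pmf (seqs ?n) (?b qs)"
      using px1 px2 nth_words[OF qs(1)] by (auto simp: seqs_eq_words intro!: is_pmf_words)
    obtain f where f: "f \<in> seqs ?m \<rightarrow>\<^sub>E seqs ?n" "code_avg (seqs ?m) (seqs ?n) (?b qs) (\<lambda>g. ?e qs f g) < \<epsilon>"
      using qs(2) by (rule code_avg_less_witness[OF finite_seqs pmf(1)])
    obtain g where g: "g \<in> seqs ?m \<rightarrow>\<^sub>E seqs ?n" "?e qs f g < \<epsilon>"
      using f(2) by (rule code_avg_less_witness[OF finite_seqs pmf(2)])
    have "mac_error_prob Psrc W ?m ?n f g (d1 \<tau> qs f g) (d2 \<tau> qs f g) < \<epsilon>"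
      using mac_error_prob_le_receivers[where W = W, OF src chan'] g(2) by (rule le_less_trans)
    moreover have "\<forall>s\<in>seqs ?m. length (f s) = ?n" "\<forall>s\<in>seqs ?m. length (g s) = ?n"
      using PiE_mem[OF f(1)] PiE_mem[OF g(1)] by (auto simp: seqs_def)
    moreover have "real ?n / real ?m = b" "0 < ?m" "0 < ?n" using k l \<tau>(2) by (auto simp: b)
    ultimately show "\<exists>m n. 0 < m \<and> 0 < n \<and> real n / real m = b \<and>
       (\<exists>(f1 :: 's1 list \<Rightarrow> 'x1 list) (f2 :: 's2 list \<Rightarrow> 'x2 list)
          (g1 :: 'y1 list \<Rightarrow> 'w1 list \<Rightarrow> 's1 list \<times> 's2 list)
          (g2 :: 'y2 list \<Rightarrow> 'w2 list \<Rightarrow> 's1 list \<times> 's2 list).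
          (\<forall>s\<in>seqs m. length (f1 s) = n) \<and> (\<forall>s\<in>seqs m. length (f2 s) = n) \<and>
          mac_error_prob Psrc W m n f1 f2 g1 g2 < \<epsilon>)"
      by blast
  qed
qed

end
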